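(* Let $x(t)$ be a solution to the reduced Chazy IV equation $x'''=3xx''+3(x')^2-3x^2x'$. Then $$\frac{xx''-2(x')^2}{x''-xx'}$$ is a solution to the reduced Chazy VI equation $x'''=xx''+5(x')^2-x^2x'$, and every solution to the latter may be obtained in this form. The solution to the reduced Chazy VI equation obtained from $x(t)$ coincides with the solution obtained from $$\frac{2xx'-x''}{x'}$$ (which is again a solution to the reduced Chazy IV equation).
   Context: The reduced Chazy IV and VI equations are the autonomous third-order ordinary differential equations displayed in the claim; primes denote derivatives with respect to the complex variable $t$. If $x(t)$ solves the reduced Chazy IV equation, then so does $(2xx'-x'')/x'$. The rational expressions are considered for solutions for which their denominators do not vanish identically.
   Formalization: Not every solution of the reduced Chazy VI equation is obtained: the nonzero constants and -P'/P with P=(t-a)^6-m(t-a) (e.g. -6/t) are excluded, since they do not arise from any x(t) whose denominator x''-xx' is not identically zero. *)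

theory Defs
  imports "HOL-Complex_Analysis.Complex_Analysis"
begin

text \<open>
  Solutions are meromorphic functions on a domain; all identities between them are identities of
  meromorphic functions. Since \<^const>\<open>deriv\<close> and division have junk values at poles and other
  singular points, they are required outside a discrete closed subset of the domain
  (filter \<^const>\<open>cosparse\<close>).
\<close>

definition chazy4_solution :: "complex set \<Rightarrow> (complex \<Rightarrow> complex) \<Rightarrow> bool" where
  "chazy4_solution A x \<longleftrightarrow> x meromorphic_on A \<and>
     (\<forall>\<^sub>\<approx>t\<in>A. deriv (deriv (deriv x)) t =
        3 * x t * deriv (deriv x) t + 3 * (deriv x t)^2 - 3 * (x t)^2 * deriv x t)"

definition chazy6_solution :: "complex set \<Rightarrow> (complex \<Rightarrow> complex) \<Rightarrow> bool" where
  "chazy6_solution A y \<longleftrightarrow> y meromorphic_on A \<and>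
     (\<forall>\<^sub>\<approx>t\<in>A. deriv (deriv (deriv y)) t =
        y t * deriv (deriv y) t + 5 * (deriv y t)^2 - (y t)^2 * deriv y t)"

definition vanishes_identically :: "complex set \<Rightarrow> (complex \<Rightarrow> complex) \<Rightarrow> bool" where
  "vanishes_identically A f \<longleftrightarrow> (\<forall>\<^sub>\<approx>t\<in>A. f t = 0)"

definition to_chazy6_denom :: "(complex \<Rightarrow> complex) \<Rightarrow> complex \<Rightarrow> complex" where
  "to_chazy6_denom x t = deriv (deriv x) t - x t * deriv x t"

definition to_chazy6 :: "(complex \<Rightarrow> complex) \<Rightarrow> complex \<Rightarrow> complex" where
  "to_chazy6 x t = (x t * deriv (deriv x) t - 2 * (deriv x t)^2) / to_chazy6_denom x t"

definition chazy4_inv :: "(complex \<Rightarrow> complex) \<Rightarrow> complex \<Rightarrow> complex" where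
  "chazy4_inv x t = (2 * x t * deriv x t - deriv (deriv x) t) / deriv x t"

text \<open>
  The second disjunct says \<open>y = - P' / P\<close> with \<open>P(t) = (t - a)^6 - m (t - a)\<close>. The functions below are
  solutions of the reduced Chazy VI equation that are not of the form \<^const>\<open>to_chazy6\<close>;
  see \<open>chazy6_exceptional_not_obtained\<close>. In terms of the two solutions \<open>x\<close> and \<open>chazy4_inv x\<close>
  one tries to recover from \<open>y\<close>, they are the degenerate cases: both are constant, or both coincide (and
  then equal \<open>-2 / (t - a)\<close>), and in these cases \<^const>\<open>to_chazy6_denom\<close> vanishes identically.
\<close>

definition chazy6_exceptional :: "complex set \<Rightarrow> (complex \<Rightarrow> complex) \<Rightarrow> bool" where
  "chazy6_exceptional A y \<longleftrightarrow>
     (\<exists>c. c \<noteq> 0 \<and> (\<forall>\<^sub>\<approx>t\<in>A. y t = c)) \<or>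
     (\<exists>a m. \<forall>\<^sub>\<approx>t\<in>A. y t = - (6 * (t - a)^5 - m) / ((t - a)^6 - m * (t - a)))"

lemma chazy_local_relations:
  fixes x x1 x2 y y1 y2 :: "complex \<Rightarrow> complex"
  assumes U: "open U"
    and d0: "\<And>t. t \<in> U \<Longrightarrow> (x has_field_derivative x1 t) (at t)"
    and d1: "\<And>t. t \<in> U \<Longrightarrow> (x1 has_field_derivative x2 t) (at t)"
    and d2: "\<And>t. t \<in> U \<Longrightarrow>
      (x2 has_field_derivative (3 * x t * x2 t + 3 * (x1 t)^2 - 3 * (x t)^2 * x1 t)) (at t)"
    and nz: "\<And>t. t \<in> U \<Longrightarrow> x1 t \<noteq> 0" "\<And>t. t \<in> U \<Longrightarrow> x2 t - x t * x1 t \<noteq> 0"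
    and y: "\<And>t. t \<in> U \<Longrightarrow> y t = (x t * x2 t - 2 * (x1 t)^2) / (x2 t - x t * x1 t)"
    and e0: "\<And>t. t \<in> U \<Longrightarrow> (y has_field_derivative y1 t) (at t)"
    and e1: "\<And>t. t \<in> U \<Longrightarrow> (y1 has_field_derivative y2 t) (at t)"
  defines "v \<equiv> \<lambda>t. 2 * x t - x2 t / x1 t"
  shows "\<And>t. t \<in> U \<Longrightarrow> x t \<noteq> v t"
    and "\<And>t. t \<in> U \<Longrightarrow> 2 * y1 t = 3 * x t * v t - 3 * y t * (x t + v t) + 2 * (y t)^2"
    and "\<And>t. t \<in> U \<Longrightarrow> y2 t = - (x t + v t) * (y1 t - (y t)^2) + 3 * y t * y1 t - (y t)^3"
proof -
  have zero_deriv: "D = 0"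
    if "\<And>t. t \<in> U \<Longrightarrow> f t = 0" "(f has_field_derivative D) (at t)" "t \<in> U" for f D t
  proof -
    have "(f has_field_derivative 0) (at t)"
      by (rule has_field_derivative_transform_within_open[OF DERIV_const[of 0] U \<open>t \<in> U\<close>])
         (use that in auto)
    then show ?thesis using DERIV_unique that(2) by blast
  qed
  have x2: "x2 t = (2 * x t - v t) * x1 t" if "t \<in> U" for t
    using nz(1)[OF that] by (simp add: v_def)
  have den: "x2 t - x t * x1 t = (x t - v t) * x1 t" if "t \<in> U" for t
    unfolding x2[OF that] by algebra
  show xv: "x t \<noteq> v t" if "t \<in> U" for t
    using den[OF that] nz(2)[OF that] by auto
  have x1: "2 * x1 t - x t * (2 * x t - v t) + y t * (x t - v t) = 0" if t: "t \<in> U" for t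
  proof -
    have "y t * (x2 t - x t * x1 t) = x t * x2 t - 2 * (x1 t)^2"
      using y[OF t] nz(2)[OF t] by simp
    then have "x1 t * (2 * x1 t - x t * (2 * x t - v t) + y t * (x t - v t)) = 0"
      unfolding den[OF t] unfolding x2[OF t] by algebra
    then show ?thesis using nz(1)[OF t] by simp
  qed
  define v1 where "v1 = (\<lambda>t. (x t)^2 + (v t)^2 - x t * v t - x1 t)"
  have v1t: "v1 t = (x t)^2 + (v t)^2 - x t * v t - x1 t" for t by (simp add: v1_def)
  have dv: "(v has_field_derivative v1 t) (at t)" if t: "t \<in> U" for t
  proof -
    have "(v has_field_derivative (2 * x1 t - ((3 * x t * x2 t + 3 * (x1 t)^2 - 3 * (x t)^2 * x1 t) * x1 t
        - x2 t * x2 t) / (x1 t * x1 t))) (at t)"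
      unfolding v_def
      by ((rule derivative_eq_intros d0[OF t] d1[OF t] d2[OF t] nz(1)[OF t] refl)+, simp)
    also have "(3 * x t * x2 t + 3 * (x1 t)^2 - 3 * (x t)^2 * x1 t) * x1 t - x2 t * x2 t =
        (2 * x1 t - v1 t) * (x1 t * x1 t)"
      unfolding x2[OF t] v1_def by algebra
    finally show ?thesis using nz(1)[OF t] by simp
  qed
  have y1: "2 * y1 t - (3 * x t * v t - 3 * y t * (x t + v t) + 2 * (y t)^2) = 0" if t: "t \<in> U" for t
  proof -
    have "2 * x2 t - (x1 t * (2 * x t - v t) + x t * (2 * x1 t - v1 t))
        + (y1 t * (x t - v t) + y t * (x1 t - v1 t)) = 0"
      by (rule zero_deriv[OF x1 _ t], assumption)
         ((rule derivative_eq_intros d0[OF t] d1[OF t] dv[OF t] e0[OF t] refl)+, simp add: algebra_simps)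
    then have "(x t - v t) * (2 * y1 t - (3 * x t * v t - 3 * y t * (x t + v t) + 2 * (y t)^2)) = 0"
      using x1[OF t] x2[OF t] v1t[of t] by algebra
    then show ?thesis using xv[OF t] by simp
  qed
  then show "2 * y1 t = 3 * x t * v t - 3 * y t * (x t + v t) + 2 * (y t)^2" if "t \<in> U" for t
    using that by simp
  show "y2 t = - (x t + v t) * (y1 t - (y t)^2) + 3 * y t * y1 t - (y t)^3" if t: "t \<in> U" for t
  proof -
    have "2 * y2 t - (3 * (x1 t * v t + x t * v1 t) - 3 * (y1 t * (x t + v t) + y t * (x1 t + v1 t))
        + 4 * y t * y1 t) = 0"
      by (rule zero_deriv[OF y1 _ t], assumption)
         ((rule derivative_eq_intros d0[OF t] dv[OF t] e0[OF t] e1[OF t] refl)+, simp add: algebra_simps)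
    then have "2 * (y2 t - (- (x t + v t) * (y1 t - (y t)^2) + 3 * y t * y1 t - (y t)^3)) = 0"
      using x1[OF t] y1[OF t] v1t[of t] by algebra
    then show ?thesis by (simp only: mult_eq_0_iff) simp
  qed
qed

lemma chazy_generic_point:
  assumes A: "open A" and x: "chazy4_solution A x"
    and nv: "\<not> vanishes_identically A (to_chazy6_denom x)"
    and y: "\<forall>\<^sub>\<approx>t\<in>A. y t = to_chazy6 x t"
    and P: "\<forall>\<^sub>\<approx>t\<in>A. P t"
  obtains U x1 x2 y1 y2 v where "open U" "U \<noteq> {}" "\<And>t. t \<in> U \<Longrightarrow> P t"
    "\<And>t. t \<in> U \<Longrightarrow> (x has_field_derivative x1 t) (at t)" "\<And>t. t \<in> U \<Longrightarrow> x1 t \<noteq> 0"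
    "\<And>t. t \<in> U \<Longrightarrow> (y has_field_derivative y1 t) (at t)"
    "\<And>t. t \<in> U \<Longrightarrow> (y1 has_field_derivative y2 t) (at t)"
    "\<And>t. t \<in> U \<Longrightarrow> x t \<noteq> v t"
    "\<And>t. t \<in> U \<Longrightarrow> 2 * y1 t = 3 * x t * v t - 3 * y t * (x t + v t) + 2 * (y t)^2"
    "\<And>t. t \<in> U \<Longrightarrow> y2 t = - (x t + v t) * (y1 t - (y t)^2) + 3 * y t * y1 t - (y t)^3"
proof -
  let ?Q = "\<lambda>t. P t \<and> x analytic_on {t} \<and> t \<in> A \<and> y t = to_chazy6 x t \<and>
    deriv (deriv (deriv x)) t = 3 * x t * deriv (deriv x) t + 3 * (deriv x t)^2 - 3 * (x t)^2 * deriv x t"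
  have Q: "\<forall>\<^sub>\<approx>t\<in>A. ?Q t"
    using P y x meromorphic_on_imp_analytic_cosparse[of x A] eventually_in_cosparse[of A A] A
    unfolding chazy4_solution_def by (auto intro!: eventually_conj)
  have "\<exists>\<^sub>F t in cosparse A. to_chazy6_denom x t \<noteq> 0"
    using nv by (simp add: vanishes_identically_def frequently_def)
  from frequently_ex[OF frequently_eventually_conj[OF this Q]] obtain t0 where
    t0: "?Q t0" "to_chazy6_denom x t0 \<noteq> 0" by auto
  have "eventually ?Q (at t0)"
    using t0(1) by (intro eventually_cosparse_imp_eventually_at[OF Q]) auto
  then have "eventually ?Q (nhds t0)"
    using t0(1) by (simp only: eventually_nhds_conv_at simp_thms)
  then obtain V where V: "open V" "t0 \<in> V" "\<And>t. t \<in> V \<Longrightarrow> ?Q t"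
    unfolding eventually_nhds by blast
  have hx: "x holomorphic_on V"
    using V(3) analytic_imp_holomorphic analytic_on_analytic_at by blast
  note h1 = holomorphic_deriv[OF hx V(1)] note h2 = holomorphic_deriv[OF h1 V(1)]
  define W where "W = {t \<in> V. to_chazy6_denom x t \<noteq> 0 }"
  have W: "open W"
  proof -
    have "continuous_on V (to_chazy6_denom x)"
      unfolding to_chazy6_denom_def [abs_def]
      by (intro continuous_intros holomorphic_on_imp_continuous_on h1 h2 hx)
    from continuous_open_preimage[OF this V(1), of "- {0}"] show ?thesis
      unfolding W_def by (simp add: vimage_def Int_def open_Compl)
  qed
  define U where "U = {t \<in> W. deriv x t \<noteq> 0}"
  have WV: "W \<subseteq> V" by (auto simp: W_def)
  have U: "open U"
  proof -
    have "continuous_on W (deriv x)"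
      using continuous_on_subset[OF holomorphic_on_imp_continuous_on[OF h1] WV] .
    from continuous_open_preimage[OF this W, of "- {0}"] show ?thesis
      unfolding U_def by (simp add: vimage_def Int_def open_Compl)
  qed
  have UV: "U \<subseteq> V" using WV by (auto simp: U_def)
  have "U \<noteq> {}"
  proof
    assume "U = {}"
    then have z: "deriv x t = 0" if "t \<in> W" for t using that by (auto simp: U_def)
    have t0W: "t0 \<in> W" using V(2) t0 by (simp add: W_def)
    have "(deriv x has_field_derivative 0) (at t0)"
      by (rule has_field_derivative_transform_within_open[OF DERIV_const[of 0] W t0W]) (use z in auto)
    then have "deriv (deriv x) t0 = 0" by (rule DERIV_imp_deriv)
    with z[OF t0W] t0(2) show False by (simp add: to_chazy6_denom_def)
  qed
  have d: "(f has_field_derivative deriv f t) (at t)" if "f holomorphic_on V" "t \<in> U" for f t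
    using that UV V(1) holomorphic_derivI by blast
  have hy: "y holomorphic_on U"
  proof -
    have "(\<lambda>t. (x t * deriv (deriv x) t - 2 * (deriv x t)^2) / (deriv (deriv x) t - x t * deriv x t)) holomorphic_on U"
      by (intro holomorphic_intros holomorphic_on_subset[OF hx UV] holomorphic_on_subset[OF h1 UV]
        holomorphic_on_subset[OF h2 UV]) (auto simp: U_def W_def to_chazy6_denom_def)
    moreover have "y t = (x t * deriv (deriv x) t - 2 * (deriv x t)^2) / (deriv (deriv x) t - x t * deriv x t)"
      if "t \<in> U" for t
      using V(3)[of t] that UV by (auto simp: to_chazy6_def to_chazy6_denom_def)
    ultimately show ?thesis by (metis (no_types, lifting) holomorphic_transform)
  qed
  note hy1 = holomorphic_deriv[OF hy U]
  have d2: "(deriv (deriv x) has_field_derivative 3 * x t * deriv (deriv x) t + 3 * (deriv x t)^2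
      - 3 * (x t)^2 * deriv x t) (at t)" if "t \<in> U" for t
    using d[OF h2 that] V(3)[of t] that UV by auto
  have nz: "deriv x t \<noteq> 0" "deriv (deriv x) t - x t * deriv x t \<noteq> 0" if "t \<in> U" for t
    using that by (auto simp: U_def W_def to_chazy6_denom_def)
  have yq: "y t = (x t * deriv (deriv x) t - 2 * (deriv x t)^2) / (deriv (deriv x) t - x t * deriv x t)"
    if "t \<in> U" for t
    using V(3)[of t] that UV by (auto simp: to_chazy6_def to_chazy6_denom_def)
  have e0: "(y has_field_derivative deriv y t) (at t)" if "t \<in> U" for t
    using that hy U holomorphic_derivI by blast
  have e1: "(deriv y has_field_derivative deriv (deriv y) t) (at t)" if "t \<in> U" for t
    using that hy1 U holomorphic_derivI by blast
  note rel = chazy_local_relations[OF U d[OF hx] d[OF h1] d2 nz yq e0 e1]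
  show ?thesis
    by (rule that[OF U \<open>U \<noteq> {}\<close> _ d[OF hx] nz(1) e0 e1 rel]) (use V(3) UV in auto)
qed

lemma chazy6_exceptional_not_obtained:
  assumes A: "open A" and ex: "chazy6_exceptional A y"
  shows "\<not> (\<exists>x. chazy4_solution A x \<and> \<not> vanishes_identically A (to_chazy6_denom x) \<and>
                 (\<forall>\<^sub>\<approx>t\<in>A. y t = to_chazy6 x t))"
proof
  assume "\<exists>x. chazy4_solution A x \<and> \<not> vanishes_identically A (to_chazy6_denom x) \<and>
              (\<forall>\<^sub>\<approx>t\<in>A. y t = to_chazy6 x t)"
  then obtain x where x: "chazy4_solution A x" "\<not> vanishes_identically A (to_chazy6_denom x)"
    "\<forall>\<^sub>\<approx>t\<in>A. y t = to_chazy6 x t" by blast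
  from ex[unfolded chazy6_exceptional_def] show False
  proof (elim disjE exE conjE)
    fix c assume c: "c \<noteq> 0" and yc: "\<forall>\<^sub>\<approx>t\<in>A. y t = c"
    obtain U x1 x2 y1 y2 v where U: "open U" "U \<noteq> {}"
      "\<And>t. t \<in> U \<Longrightarrow> y t = c"
      "\<And>t. t \<in> U \<Longrightarrow> (x has_field_derivative x1 t) (at t)" "\<And>t. t \<in> U \<Longrightarrow> x1 t \<noteq> 0"
      "\<And>t. t \<in> U \<Longrightarrow> (y has_field_derivative y1 t) (at t)"
      "\<And>t. t \<in> U \<Longrightarrow> (y1 has_field_derivative y2 t) (at t)"
      "\<And>t. t \<in> U \<Longrightarrow> x t \<noteq> v t"
      "\<And>t. t \<in> U \<Longrightarrow> 2 * y1 t = 3 * x t * v t - 3 * y t * (x t + v t) + 2 * (y t)^2"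
      "\<And>t. t \<in> U \<Longrightarrow> y2 t = - (x t + v t) * (y1 t - (y t)^2) + 3 * y t * y1 t - (y t)^3"
      by (rule chazy_generic_point[OF A x yc]) (rule that, assumption+)
    obtain t where t: "t \<in> U" using U(2) by auto
    have const: "D = 0" if "\<And>t. t \<in> U \<Longrightarrow> f t = k" "(f has_field_derivative D) (at t)" "t \<in> U"
      for f D k t
    proof -
      have "(f has_field_derivative 0) (at t)"
        by (rule has_field_derivative_transform_within_open[OF DERIV_const[of k] U(1) that(3)])
           (use that(1) in auto)
      then show ?thesis using DERIV_unique that(2) by blast
    qed
    have y1: "y1 s = 0" if "s \<in> U" for s using const[OF U(3) U(6)] that by blast
    have y2: "y2 s = 0" if "s \<in> U" for s using const[OF y1 U(7)] that by blast
    have sum: "v s = c - x s" if "s \<in> U" for s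
    proof -
      have "c^2 * (x s + v s - c) = 0"
        using U(10)[OF that] y1[OF that] y2[OF that] U(3)[OF that] by algebra
      then have "x s + v s - c = 0" using c by simp
      then show ?thesis by (simp add: algebra_simps)
    qed
    have quad: "3 * (x s)^2 - 3 * c * x s + c^2 = 0" if "s \<in> U" for s
      using U(9)[OF that] y1[OF that] sum[OF that] U(3)[OF that] by algebra
    have "x1 t * (6 * x t - 3 * c) = 0"
      by (rule const[OF quad _ t], assumption)
         ((rule derivative_eq_intros U(4)[OF t] refl)+, simp add: algebra_simps)
    then have "6 * x t - 3 * c = 0" using U(5)[OF t] by simp
    then have "c^2 = 0" using quad[OF t] by algebra
    with c show False by simp
  next
    fix a m assume yP: "\<forall>\<^sub>\<approx>t\<in>A. y t = - (6 * (t - a)^5 - m) / ((t - a)^6 - m * (t - a))"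
    obtain U x1 x2 y1 y2 v where U: "open U" "U \<noteq> {}"
      "\<And>t. t \<in> U \<Longrightarrow> y t = - (6 * (t - a)^5 - m) / ((t - a)^6 - m * (t - a))"
      "\<And>t. t \<in> U \<Longrightarrow> (x has_field_derivative x1 t) (at t)" "\<And>t. t \<in> U \<Longrightarrow> x1 t \<noteq> 0"
      "\<And>t. t \<in> U \<Longrightarrow> (y has_field_derivative y1 t) (at t)"
      "\<And>t. t \<in> U \<Longrightarrow> (y1 has_field_derivative y2 t) (at t)"
      "\<And>t. t \<in> U \<Longrightarrow> x t \<noteq> v t"
      "\<And>t. t \<in> U \<Longrightarrow> 2 * y1 t = 3 * x t * v t - 3 * y t * (x t + v t) + 2 * (y t)^2"
      "\<And>t. t \<in> U \<Longrightarrow> y2 t = - (x t + v t) * (y1 t - (y t)^2) + 3 * y t * y1 t - (y t)^3"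
      by (rule chazy_generic_point[OF A x yP]) (rule that, assumption+)
    define p where "p = [:-a, 1:] ^ 6 - smult m [:-a, 1:]"
    have pp: "poly p t = (t - a)^6 - m * (t - a)" for t
      by (simp add: p_def algebra_simps)
    have "infinite U" using U(1,2) finite_imp_not_open by blast
    have "degree p = 6"
      unfolding p_def by (subst diff_conv_add_uminus, subst degree_add_eq_left)
         (auto simp: degree_linear_power)
    then have "finite {t. poly p t = 0}" by (intro poly_roots_finite) auto
    then have fin: "finite ({t. poly p t = 0} \<union> {a})" by simp
    define S where "S = U - ({t. poly p t = 0} \<union> {a})"
    have S: "open S" unfolding S_def by (intro open_Diff U(1) finite_imp_closed fin)
    have "S \<noteq> {}" unfolding S_def using \<open>infinite U\<close> fin by (metis Diff_eq_empty_iff finite_subset)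
    then obtain t where t: "t \<in> S" by auto
    have SU: "S \<subseteq> U" by (auto simp: S_def)
    define Q where "Q = (\<lambda>t. (t - a)^6 - m * (t - a))"
    define Q1 where "Q1 = (\<lambda>t. 6 * (t - a)^5 - m)"
    have yQ: "y s * Q s + Q1 s = 0" if "s \<in> S" for s
      using U(3)[of s] that SU pp[of s] by (auto simp: S_def Q_def Q1_def)
    have zero: "D = 0" if "\<And>t. t \<in> S \<Longrightarrow> f t = 0" "(f has_field_derivative D) (at t)" "t \<in> S"
      for f D t
    proof -
      have "(f has_field_derivative 0) (at t)"
        by (rule has_field_derivative_transform_within_open[OF DERIV_const[of 0] S that(3)])
           (use that(1) in auto)
      then show ?thesis using DERIV_unique that(2) by blast
    qed
    have dQ: "(Q has_field_derivative Q1 s) (at s)" for s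
      unfolding Q_def Q1_def by (rule derivative_eq_intros refl)+ simp
    have dQ1: "(Q1 has_field_derivative 30 * (s - a)^4) (at s)" for s
      unfolding Q1_def by (rule derivative_eq_intros refl)+ simp
    have dy: "y1 s * Q s + y s * Q1 s + 30 * (s - a)^4 = 0" if "s \<in> S" for s
      by (rule zero[OF yQ _ that], assumption)
         ((rule derivative_eq_intros U(6)[OF subsetD[OF SU that]] dQ dQ1 refl)+, simp add: algebra_simps)
    have ddy: "y2 s * Q s + 2 * y1 s * Q1 s + y s * (30 * (s - a)^4) + 120 * (s - a)^3 = 0"
      if "s \<in> S" for s
      by (rule zero[OF dy _ that], assumption)
         ((rule derivative_eq_intros U(6,7)[OF subsetD[OF SU that]] dQ dQ1 refl)+, simp add: algebra_simps)
    define B where "B = y1 t - (y t)^2"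
    define C where "C = 3 * y t * y1 t - (y t)^3 - y2 t"
    have tU: "t \<in> U" using t SU by blast
    have Qnz: "Q t \<noteq> 0" and ta: "t - a \<noteq> 0" using t pp[of t] by (auto simp: S_def Q_def)
    have BQ: "B * Q t = - 30 * (t - a)^4"
      using yQ[OF t] dy[OF t] unfolding B_def by algebra
    have CQ: "C * Q t = 120 * (t - a)^3"
      using yQ[OF t] dy[OF t] ddy[OF t] unfolding C_def by algebra
    have "B \<noteq> 0" using BQ ta by auto
    have s: "(x t + v t) * B = C" using U(10)[OF tU] unfolding B_def C_def by algebra
    have q: "3 * (x t * v t) = 2 * B + 3 * y t * (x t + v t)"
      using U(9)[OF tU] unfolding B_def by algebra
    have "3 * (x t - v t)^2 * B^2 = 3 * ((x t + v t) * B)^2 - 4 * (3 * (x t * v t)) * B^2"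
      by (simp add: power2_eq_square algebra_simps)
    also have "\<dots> = 3 * C^2 - 8 * B^3 - 12 * y t * ((x t + v t) * B) * B"
      unfolding q unfolding s[symmetric] by (simp add: power2_eq_square power3_eq_cube algebra_simps)
    also have "\<dots> = 3 * C^2 - 12 * y t * C * B - 8 * B^3"
      unfolding s by simp
    finally have "3 * (x t - v t)^2 * B^2 * Q t^3
        = (3 * C^2 - 12 * y t * C * B - 8 * B^3) * Q t^3" by simp
    also have "\<dots> = 3 * (C * Q t)^2 * Q t - 12 * (y t * Q t) * (C * Q t) * (B * Q t) - 8 * (B * Q t)^3"
      by (simp add: power2_eq_square power3_eq_cube algebra_simps)
    also have "y t * Q t = - Q1 t" using yQ[OF t] by (simp add: eq_neg_iff_add_eq_0)
    also have "3 * (C * Q t)^2 * Q t - 12 * (- Q1 t) * (C * Q t) * (B * Q t) - 8 * (B * Q t)^3 = 0"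
    proof -
      have "3 * (120 * r^3)^2 * (r^6 - m * r) - 12 * (- (6 * r^5 - m)) * (120 * r^3) * (- 30 * r^4)
          - 8 * (- 30 * r^4)^3 = 0" for r :: complex
        by algebra
      then show ?thesis unfolding BQ CQ unfolding Q_def Q1_def .
    qed
    finally show False using Qnz \<open>B \<noteq> 0\<close> U(8)[OF tU] by simp
  qed
qed

end

theory Submission
  imports Defs
begin

text \<open>
  With \<open>v = 2 x - x'' / x'\<close> and \<open>y = (x x'' - 2 x'\<^sup>2) / (x'' - x x')\<close>, the triple \<open>(x, v, y)\<close>
  satisfies a quadratic first-order system symmetric in \<open>x\<close> and \<open>v\<close>, which in turn implies the
  Chazy IV equation for \<open>x\<close> and \<open>v\<close> and the Chazy VI equation for \<open>y\<close>. Conversely, the sum and the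
  product of \<open>x\<close> and \<open>v\<close> are rational in \<open>y, y', y''\<close>, so \<open>x\<close> and \<open>v\<close> are locally the roots of a
  quadratic equation; its degenerate cases give the exceptional solutions and those with
  \<open>y' = y\<^sup>2\<close>. Although \<open>A\<close> need not be simply connected, the roots have no monodromy: since
  \<open>x = - u' / u\<close> with \<open>u''' = k u\<close>, every local solution of Chazy IV is the restriction of a
  meromorphic function on the plane, and the identity theorem carries all relations to \<open>A\<close>.
\<close>

subsection \<open>Identities between meromorphic functions\<close>

text \<open>Clears the factor 1/2 carried by \<open>chazy_system\<close>, so that its relations
  become polynomial identities accessible to \<open>algebra\<close>.\<close>

lemma eq_half_iff: "a = b / 2 \<longleftrightarrow> 2 * a = b" for a b :: complex
  by (auto simp: field_simps)

lemma deriv_eq_on_open: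
  assumes "open U" "t \<in> U" "\<And>s. s \<in> U \<Longrightarrow> f s = g s" "(g has_field_derivative D) (at t)"
  shows "deriv f t = D"
  using has_field_derivative_transform_within_open[OF assms(4,1,2)] assms(3)
  by (simp add: DERIV_imp_deriv)

text \<open>The property holds at some point of \<open>A\<close> and, being cosparse, on a punctured
  neighbourhood of that point; together these contain a full ball.\<close>

lemma cosparse_imp_ball:
  fixes A :: "complex set"
  assumes "open A" "A \<noteq> {}" "\<forall>\<^sub>\<approx>t\<in>A. P t"
  obtains c r where "r > 0" "ball c r \<subseteq> A" "\<And>t. t \<in> ball c r \<Longrightarrow> P t"
proof -
  let ?Q = "\<lambda>t. P t \<and> t \<in> A"
  have Q: "\<forall>\<^sub>\<approx>t\<in>A. ?Q t"
    using assms eventually_in_cosparse[of A A] by (auto intro: eventually_conj)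
  have "cosparse A \<noteq> bot" using assms by simp
  then obtain c where c: "?Q c" using eventually_happens Q by blast
  have "eventually ?Q (at c)"
    using c by (intro eventually_cosparse_imp_eventually_at[OF Q]) auto
  then have "eventually ?Q (nhds c)"
    using c by (simp only: eventually_nhds_conv_at simp_thms)
  then show ?thesis
    using that unfolding eventually_nhds_metric by (metis dist_commute mem_ball subsetI)
qed

text \<open>On a connected domain the difference is either zero or nonzero off a discrete set, and
  agreement on an open set excludes the latter. This carries every relation found on a ball to all
  of \<open>A\<close>.\<close>

lemma identity_meromorphic:
  assumes A: "open A" "connected A" and f: "f meromorphic_on A" and g: "g meromorphic_on A"
    and U: "open U" "U \<noteq> {}" "U \<subseteq> A" "\<And>t. t \<in> U \<Longrightarrow> f t = g t"
  shows "\<forall>\<^sub>\<approx>t\<in>A. f t = g t"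
proof -
  have "(\<lambda>t. f t - g t) meromorphic_on A" using f g by (intro meromorphic_intros)
  from meromorphic_imp_constant_or_avoid[OF this A, of 0] show ?thesis
  proof
    assume nz: "\<forall>\<^sub>\<approx>t\<in>A. f t - g t \<noteq> 0"
    obtain t where t: "t \<in> U" using U(2) by blast
    have "eventually (\<lambda>s. f s - g s \<noteq> 0) (at t)"
      using t U(3) by (intro eventually_cosparse_imp_eventually_at[OF nz]) auto
    moreover have "eventually (\<lambda>s. s \<in> U) (at t)"
      using t U(1) by (simp add: eventually_at_in_open')
    ultimately have "eventually (\<lambda>_. False) (at t)"
      by eventually_elim (use U(4) in auto)
    then show ?thesis by simp
  qed simp
qed

lemma chazy4_solutionI:
  assumes "open A" "connected A" "x meromorphic_on A" "open U" "U \<noteq> {}" "U \<subseteq> A"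
    and "\<And>t. t \<in> U \<Longrightarrow> deriv (deriv (deriv x)) t =
      3 * x t * deriv (deriv x) t + 3 * (deriv x t)^2 - 3 * (x t)^2 * deriv x t"
  shows "chazy4_solution A x"
  unfolding chazy4_solution_def
  using assms by (intro conjI identity_meromorphic[of A _ _ U] meromorphic_intros) auto

lemma chazy6_solutionI:
  assumes "open A" "connected A" "y meromorphic_on A" "open U" "U \<noteq> {}" "U \<subseteq> A"
    and "\<And>t. t \<in> U \<Longrightarrow> deriv (deriv (deriv y)) t =
      y t * deriv (deriv y) t + 5 * (deriv y t)^2 - (y t)^2 * deriv y t"
  shows "chazy6_solution A y"
  unfolding chazy6_solution_def
  using assms by (intro conjI identity_meromorphic[of A _ _ U] meromorphic_intros) auto

lemma meromorphic_to_chazy6_denom [meromorphic_intros]: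
  "x meromorphic_on A \<Longrightarrow> to_chazy6_denom x meromorphic_on A"
  unfolding to_chazy6_denom_def[abs_def] by (intro meromorphic_intros)

lemma meromorphic_to_chazy6 [meromorphic_intros]:
  "x meromorphic_on A \<Longrightarrow> to_chazy6 x meromorphic_on A"
  unfolding to_chazy6_def[abs_def] by (intro meromorphic_intros)

lemma meromorphic_chazy4_inv [meromorphic_intros]:
  "x meromorphic_on A \<Longrightarrow> chazy4_inv x meromorphic_on A"
  unfolding chazy4_inv_def[abs_def] by (intro meromorphic_intros)

lemma nonvanishing_imp_avoid:
  assumes "open A" "connected A" "f meromorphic_on A" "\<not> vanishes_identically A f"
  shows "\<forall>\<^sub>\<approx>t\<in>A. f t \<noteq> 0"
  using meromorphic_imp_constant_or_avoid[OF assms(3,1,2), of 0] assms(4)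
  by (auto simp: vanishes_identically_def)

lemma nonvanishingI:
  assumes "open A" "open U" "U \<noteq> {}" "U \<subseteq> A" "\<And>t. t \<in> U \<Longrightarrow> f t \<noteq> 0"
  shows "\<not> vanishes_identically A f"
proof
  assume z: "vanishes_identically A f"
  obtain t where t: "t \<in> U" using assms by blast
  have "eventually (\<lambda>s. f s = 0) (at t)"
    using t assms(4) z unfolding vanishes_identically_def
    by (auto intro: eventually_cosparse_imp_eventually_at)
  moreover have "eventually (\<lambda>s. s \<in> U) (at t)"
    using t assms(2) by (simp add: eventually_at_in_open')
  ultimately have "eventually (\<lambda>_. False) (at t)"
    by eventually_elim (use assms(5) in auto)
  then show False by simp
qed

text \<open>A point close to \<open>t\<close> but distinct from it has a whole neighbourhood of
  agreement, namely \<open>S - {t}\<close>, so the derivatives agree there; nothing is claimed at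
  \<open>t\<close> itself.\<close>

lemma cosparse_deriv_cong:
  assumes "open A" and eq: "\<forall>\<^sub>\<approx>t\<in>A. f t = g t"
  shows "\<forall>\<^sub>\<approx>t\<in>A. deriv f t = deriv g t"
  unfolding eventually_cosparse_open_eq[OF assms(1)]
proof
  fix t assume "t \<in> A"
  then have "eventually (\<lambda>s. f s = g s) (at t)"
    by (rule eventually_cosparse_imp_eventually_at[OF eq])
  then obtain S where S: "open S" "t \<in> S" "\<And>s. s \<in> S \<Longrightarrow> s \<noteq> t \<Longrightarrow> f s = g s"
    unfolding eventually_at_topological by blast
  have "eventually (\<lambda>u. f u = g u) (nhds s)" if "s \<in> S" "s \<noteq> t" for s
    unfolding eventually_nhds using S that by (intro exI[of _ "S - {t}"]) auto
  then have "eventually (\<lambda>s. eventually (\<lambda>u. f u = g u) (nhds s)) (at t)"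
    unfolding eventually_at_topological using S(1,2) by blast
  then show "eventually (\<lambda>s. deriv f s = deriv g s) (at t)"
    by eventually_elim (rule deriv_cong_ev, auto)
qed

subsection \<open>The quadratic system\<close>

text \<open>The intended instance is \<open>v = chazy4_inv x\<close>, \<open>y = to_chazy6 x\<close>.\<close>

definition chazy_system ::
  "complex set \<Rightarrow> (complex \<Rightarrow> complex) \<Rightarrow> (complex \<Rightarrow> complex) \<Rightarrow> (complex \<Rightarrow> complex) \<Rightarrow> bool" where
  "chazy_system U x v y \<longleftrightarrow> (\<forall>t\<in>U.
     (x has_field_derivative (x t * (2 * x t - v t) - y t * (x t - v t)) / 2) (at t) \<and>
     (v has_field_derivative (v t * (2 * v t - x t) - y t * (v t - x t)) / 2) (at t) \<and>
     (y has_field_derivative (3 * x t * v t - 3 * y t * (x t + v t) + 2 * (y t)^2) / 2) (at t))"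

text \<open>This symmetry transfers every consequence for \<open>x\<close> to \<open>v\<close>; it
  is the source of both statements about \<open>chazy4_inv\<close>.\<close>

lemma chazy_system_sym: "chazy_system U x v y \<Longrightarrow> chazy_system U v x y"
  unfolding chazy_system_def by (auto simp: algebra_simps)

text \<open>Differentiating the first equation gives \<open>x'' = (2 x - v) x'\<close>, which is the
  definition of \<open>v\<close> as \<open>chazy4_inv x\<close>; one more derivative gives Chazy IV.
  For \<open>y\<close>, the second derivative is linear in \<open>x + v\<close>, and differentiating
  it leads to Chazy VI.\<close>

lemma chazy_system_derivs:
  assumes U: "open U" and sys: "chazy_system U x v y" and t: "t \<in> U"
  shows chazy_system_deriv: "deriv x t = (x t * (2 * x t - v t) - y t * (x t - v t)) / 2"
    and chazy_system_deriv2: "deriv (deriv x) t = (2 * x t - v t) * deriv x t"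
    and chazy_system_chazy4: "deriv (deriv (deriv x)) t =
      3 * x t * deriv (deriv x) t + 3 * (deriv x t)^2 - 3 * (x t)^2 * deriv x t"
    and chazy_system_chazy6: "deriv (deriv (deriv y)) t =
      y t * deriv (deriv y) t + 5 * (deriv y t)^2 - (y t)^2 * deriv y t"
proof -
  note d = sys[unfolded chazy_system_def, rule_format]
  have d1: "(x has_field_derivative deriv x s) (at s)" "(v has_field_derivative deriv v s) (at s)"
     "(y has_field_derivative deriv y s) (at s)" if "s \<in> U" for s
    using d[OF that] DERIV_imp_deriv by metis+
  have e: "deriv x s = (x s * (2 * x s - v s) - y s * (x s - v s)) / 2"
    "deriv v s = (v s * (2 * v s - x s) - y s * (v s - x s)) / 2"
    "deriv y s = (3 * x s * v s - 3 * y s * (x s + v s) + 2 * (y s)^2) / 2" if "s \<in> U" for s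
    using d[OF that] DERIV_imp_deriv by blast+
  have e': "2 * deriv x s = x s * (2 * x s - v s) - y s * (x s - v s)"
    "2 * deriv v s = v s * (2 * v s - x s) - y s * (v s - x s)"
    "2 * deriv y s = 3 * x s * v s - 3 * y s * (x s + v s) + 2 * (y s)^2" if "s \<in> U" for s
    using e[OF that] unfolding eq_half_iff .
  have d2: "(deriv f has_field_derivative deriv (deriv f) s) (at s)"
    if "\<And>s. s \<in> U \<Longrightarrow> (f has_field_derivative deriv f s) (at s)" "s \<in> U" for f s
  proof -
    have "f holomorphic_on U" using that(1) U by (auto simp: holomorphic_on_open)
    then show ?thesis using holomorphic_derivI[OF holomorphic_deriv U] U that(2) by blast
  qed
  have d2: "(deriv x has_field_derivative deriv (deriv x) t) (at t)"
    "(deriv y has_field_derivative deriv (deriv y) t) (at t)"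
    by (rule d2[OF d1(1) t], assumption) (rule d2[OF d1(3) t], assumption)
  \<comment> \<open>In the sum of the equations for \<open>x'\<close> and \<open>v'\<close> the
    terms with \<open>y\<close> cancel.\<close>
  have xv: "deriv v s = (x s)^2 + (v s)^2 - x s * v s - deriv x s" if "s \<in> U" for s
  proof -
    have "2 * deriv v s = 2 * ((x s)^2 + (v s)^2 - x s * v s - deriv x s)"
      using e'(1,2)[OF that] by algebra
    then show ?thesis by (simp only: mult_cancel_left) simp
  qed
  have x2: "deriv (deriv x) s = (2 * x s - v s) * deriv x s" if s: "s \<in> U" for s
  proof -
    have "deriv (deriv x) s = (deriv x s * (2 * x s - v s) + x s * (2 * deriv x s - deriv v s)
        - (deriv y s * (x s - v s) + y s * (deriv x s - deriv v s))) / 2"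
      by (rule deriv_eq_on_open[OF U s e(1)], assumption, rule DERIV_cdivide)
         ((rule derivative_eq_intros d1[OF s] refl)+, simp add: algebra_simps)
    also have "deriv x s * (2 * x s - v s) + x s * (2 * deriv x s - deriv v s)
        - (deriv y s * (x s - v s) + y s * (deriv x s - deriv v s)) = 2 * ((2 * x s - v s) * deriv x s)"
      using e'[OF s] xv[OF s] by algebra
    finally show ?thesis by simp
  qed
  have y2: "deriv (deriv y) s = - (x s + v s) * (deriv y s - (y s)^2) + 3 * y s * deriv y s - (y s)^3"
    if s: "s \<in> U" for s
  proof -
    have "deriv (deriv y) s = (3 * (deriv x s * v s + x s * deriv v s)
        - 3 * (deriv y s * (x s + v s) + y s * (deriv x s + deriv v s)) + 4 * y s * deriv y s) / 2"
      by (rule deriv_eq_on_open[OF U s e(3)], assumption, rule DERIV_cdivide)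
         ((rule derivative_eq_intros d1[OF s] refl)+, simp add: algebra_simps)
    also have "3 * (deriv x s * v s + x s * deriv v s)
        - 3 * (deriv y s * (x s + v s) + y s * (deriv x s + deriv v s)) + 4 * y s * deriv y s
      = 2 * (- (x s + v s) * (deriv y s - (y s)^2) + 3 * y s * deriv y s - (y s)^3)"
      using e'[OF s] xv[OF s] by algebra
    finally show ?thesis by (simp only: eq_half_iff mult_cancel_left) simp
  qed
  show "deriv x t = (x t * (2 * x t - v t) - y t * (x t - v t)) / 2"
    and "deriv (deriv x) t = (2 * x t - v t) * deriv x t"
    using e(1)[OF t] x2[OF t] .
  have "deriv (deriv (deriv x)) t = (2 * deriv x t - deriv v t) * deriv x t + (2 * x t - v t) * deriv (deriv x) t"
    by (rule deriv_eq_on_open[OF U t x2], assumption)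
       ((rule derivative_eq_intros d1[OF t] d2 refl)+, simp_all add: algebra_simps)
  then show "deriv (deriv (deriv x)) t =
      3 * x t * deriv (deriv x) t + 3 * (deriv x t)^2 - 3 * (x t)^2 * deriv x t"
    using x2[OF t] xv[OF t] by algebra
  have "deriv (deriv (deriv y)) t = - (deriv x t + deriv v t) * (deriv y t - (y t)^2)
      - (x t + v t) * (deriv (deriv y) t - 2 * y t * deriv y t)
      + 3 * (deriv y t)^2 + 3 * y t * deriv (deriv y) t - 3 * (y t)^2 * deriv y t"
    by (rule deriv_eq_on_open[OF U t y2], assumption)
       ((rule derivative_eq_intros d1[OF t] d2 refl)+, simp add: algebra_simps power2_eq_square)
  then show "deriv (deriv (deriv y)) t =
      y t * deriv (deriv y) t + 5 * (deriv y t)^2 - (y t)^2 * deriv y t"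
    using e'(3)[OF t] xv[OF t] y2[OF t] by algebra
qed

text \<open>Hence the denominator degenerates exactly where the two solutions meet or
  \<open>x\<close> is stationary.\<close>

lemma chazy_system_denom:
  assumes "open U" "chazy_system U x v y" "t \<in> U"
  shows "to_chazy6_denom x t = (x t - v t) * deriv x t"
  unfolding to_chazy6_denom_def chazy_system_deriv2[OF assms] by algebra

lemma chazy_system_to_chazy6:
  assumes "open U" "chazy_system U x v y" "t \<in> U" "to_chazy6_denom x t \<noteq> 0"
  shows "to_chazy6 x t = y t"
proof -
  have "2 * deriv x t = x t * (2 * x t - v t) - y t * (x t - v t)"
    using chazy_system_deriv[OF assms(1-3)] unfolding eq_half_iff .
  then have "x t * deriv (deriv x) t - 2 * (deriv x t)^2 = y t * to_chazy6_denom x t"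
    unfolding to_chazy6_denom_def chazy_system_deriv2[OF assms(1-3)] by algebra
  then show ?thesis using assms(4) by (simp add: to_chazy6_def)
qed

text \<open>The formula for \<open>y\<close> is the first equation of the system, solved for
  \<open>y\<close>. The equation for \<open>v'\<close> comes from differentiating
  \<open>2 x - x'' / x'\<close> and substituting Chazy IV; the one for \<open>y'\<close> is supplied
  by \<open>chazy_local_relations\<close>.\<close>

lemma chazy4_imp_chazy_system:
  assumes U: "open U" and hx: "x holomorphic_on U"
    and eq: "\<And>t. t \<in> U \<Longrightarrow> deriv (deriv (deriv x)) t =
      3 * x t * deriv (deriv x) t + 3 * (deriv x t)^2 - 3 * (x t)^2 * deriv x t"
    and nz1: "\<And>t. t \<in> U \<Longrightarrow> deriv x t \<noteq> 0"
    and nz2: "\<And>t. t \<in> U \<Longrightarrow> to_chazy6_denom x t \<noteq> 0"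
  shows "chazy_system U x (chazy4_inv x) (to_chazy6 x)"
  unfolding chazy_system_def
proof (intro ballI conjI)
  fix t assume t: "t \<in> U"
  define v where "v = chazy4_inv x"
  define y where "y = to_chazy6 x"
  note h1 = holomorphic_deriv[OF hx U] note h2 = holomorphic_deriv[OF h1 U]
  have d: "(f has_field_derivative deriv f s) (at s)" if "f holomorphic_on U" "s \<in> U" for f s
    using that U holomorphic_derivI by blast
  have d2: "(deriv (deriv x) has_field_derivative
      3 * x s * deriv (deriv x) s + 3 * (deriv x s)^2 - 3 * (x s)^2 * deriv x s) (at s)"
    if "s \<in> U" for s
    using d[OF h2 that] unfolding eq[OF that] .
  have yq: "y s = (x s * deriv (deriv x) s - 2 * (deriv x s)^2) / (deriv (deriv x) s - x s * deriv x s)"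
    for s by (simp add: y_def to_chazy6_def to_chazy6_denom_def)
  have nz2': "deriv (deriv x) s - x s * deriv x s \<noteq> 0" if "s \<in> U" for s
    using nz2[OF that] by (simp add: to_chazy6_denom_def)
  have "(\<lambda>s. (x s * deriv (deriv x) s - 2 * (deriv x s)^2) / (deriv (deriv x) s - x s * deriv x s)) holomorphic_on U"
    using nz2' by (intro holomorphic_intros hx h1 h2) auto
  then have hy: "y holomorphic_on U" unfolding yq[symmetric] .
  have v: "v s = 2 * x s - deriv (deriv x) s / deriv x s" if "s \<in> U" for s
    using nz1[OF that] by (simp add: v_def chazy4_inv_def field_simps)
  have x2: "deriv (deriv x) t = (2 * x t - v t) * deriv x t"
    using v[OF t] nz1[OF t] by simp
  have x1: "2 * deriv x t = x t * (2 * x t - v t) - y t * (x t - v t)"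
  proof -
    have "y t * (deriv (deriv x) t - x t * deriv x t) = x t * deriv (deriv x) t - 2 * (deriv x t)^2"
      using yq nz2'[OF t] by simp
    then have "deriv x t * (2 * deriv x t) = deriv x t * (x t * (2 * x t - v t) - y t * (x t - v t))"
      unfolding x2 by algebra
    then show ?thesis using nz1[OF t] by simp
  qed
  show "(x has_field_derivative (x t * (2 * x t - v t) - y t * (x t - v t)) / 2) (at t)"
    using d[OF hx t] unfolding x1[symmetric] by simp
  have "(v has_field_derivative (2 * deriv x t -
      ((3 * x t * deriv (deriv x) t + 3 * (deriv x t)^2 - 3 * (x t)^2 * deriv x t) * deriv x t
        - deriv (deriv x) t * deriv (deriv x) t) / (deriv x t * deriv x t))) (at t)"
    by (rule has_field_derivative_transform_within_open[OF _ U t v[symmetric]])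
       ((rule derivative_eq_intros d[OF hx t] d[OF h1 t] d2[OF t] nz1[OF t] refl)+, simp_all)
  also have "(3 * x t * deriv (deriv x) t + 3 * (deriv x t)^2 - 3 * (x t)^2 * deriv x t) * deriv x t
        - deriv (deriv x) t * deriv (deriv x) t
      = (3 * deriv x t - (x t)^2 - (v t)^2 + x t * v t) * (deriv x t * deriv x t)"
    unfolding x2 by algebra
  also have "2 * deriv x t - \<dots> / (deriv x t * deriv x t) = (x t)^2 + (v t)^2 - x t * v t - deriv x t"
    using nz1[OF t] by simp
  finally have "(v has_field_derivative (x t)^2 + (v t)^2 - x t * v t - deriv x t) (at t)" .
  also have "(x t)^2 + (v t)^2 - x t * v t - deriv x t = (v t * (2 * v t - x t) - y t * (v t - x t)) / 2"
  proof -
    have "2 * ((x t)^2 + (v t)^2 - x t * v t - deriv x t) = v t * (2 * v t - x t) - y t * (v t - x t)"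
      using x1 by algebra
    then show ?thesis unfolding eq_half_iff .
  qed
  finally show "(v has_field_derivative (v t * (2 * v t - x t) - y t * (v t - x t)) / 2) (at t)" .
  note rel = chazy_local_relations(2)[OF U d[OF hx] d[OF h1] d2 nz1 nz2' yq d[OF hy]
    d[OF holomorphic_deriv[OF hy U]] t, folded v[OF t]]
  show "(y has_field_derivative (3 * x t * v t - 3 * y t * (x t + v t) + 2 * (y t)^2) / 2) (at t)"
    using d[OF hy t] rel[folded eq_half_iff] by (simp only:)
qed

section \<open>From Chazy IV to Chazy VI on the whole domain, and the involution\<close>

lemma generic_ball:
  fixes A :: "complex set"
  assumes A: "open A" "A \<noteq> {}" and f: "f meromorphic_on A" and P: "\<forall>\<^sub>\<approx>t\<in>A. P t"
  obtains c r where "r > 0" "ball c r \<subseteq> A" "f holomorphic_on ball c r"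
    "\<And>t. t \<in> ball c r \<Longrightarrow> P t"
proof -
  have "\<forall>\<^sub>\<approx>t\<in>A. f analytic_on {t} \<and> P t"
    using meromorphic_on_imp_analytic_cosparse[OF f] P by (rule eventually_conj)
  then obtain c r where "r > 0" "ball c r \<subseteq> A"
    and *: "\<And>t. t \<in> ball c r \<Longrightarrow> f analytic_on {t} \<and> P t"
    by (rule cosparse_imp_ball[OF A]) (rule that, assumption+)
  moreover have "f holomorphic_on ball c r"
    using * analytic_imp_holomorphic analytic_on_analytic_at by blast
  ultimately show ?thesis using that by blast
qed

text \<open>The predicate \<open>P\<close> lets further cosparse conditions be imposed on the same
  ball, such as the nonvanishing of a second denominator.\<close>

lemma chazy4_generic_system:
  assumes A: "open A" "connected A" and x: "chazy4_solution A x"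
    and nv: "\<not> vanishes_identically A (to_chazy6_denom x)"
    and P: "\<forall>\<^sub>\<approx>t\<in>A. P t"
  obtains c r where "r > 0" "ball c r \<subseteq> A"
    "chazy_system (ball c r) x (chazy4_inv x) (to_chazy6 x)"
    "\<And>t. t \<in> ball c r \<Longrightarrow> P t"
proof -
  have mx: "x meromorphic_on A" using x by (simp add: chazy4_solution_def)
  have ne: "A \<noteq> {}" using nv by (auto simp: vanishes_identically_def)
  have nz2: "\<forall>\<^sub>\<approx>t\<in>A. to_chazy6_denom x t \<noteq> 0"
    by (intro nonvanishing_imp_avoid A nv meromorphic_intros mx)
  \<comment> \<open>If \<open>x'\<close> vanished identically, so would \<open>x''\<close> and with
    them the denominator \<open>x'' - x x'\<close>.\<close>
  have "\<not> vanishes_identically A (deriv x)"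
  proof
    assume z: "vanishes_identically A (deriv x)"
    then have "\<forall>\<^sub>\<approx>t\<in>A. deriv (deriv x) t = deriv (\<lambda>_. 0) t"
      unfolding vanishes_identically_def by (rule cosparse_deriv_cong[OF A(1)])
    with z have "vanishes_identically A (to_chazy6_denom x)"
      unfolding vanishes_identically_def
      by eventually_elim (simp add: to_chazy6_denom_def)
    with nv show False ..
  qed
  then have nz1: "\<forall>\<^sub>\<approx>t\<in>A. deriv x t \<noteq> 0"
    by (intro nonvanishing_imp_avoid A meromorphic_intros mx)
  from x have eq: "\<forall>\<^sub>\<approx>t\<in>A. deriv (deriv (deriv x)) t =
      3 * x t * deriv (deriv x) t + 3 * (deriv x t)^2 - 3 * (x t)^2 * deriv x t"
    by (simp add: chazy4_solution_def)
  obtain c r where U: "r > 0" "ball c r \<subseteq> A" "x holomorphic_on ball c r"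
    "\<And>t. t \<in> ball c r \<Longrightarrow> deriv x t \<noteq> 0 \<and> to_chazy6_denom x t \<noteq> 0 \<and> P t \<and>
      deriv (deriv (deriv x)) t =
      3 * x t * deriv (deriv x) t + 3 * (deriv x t)^2 - 3 * (x t)^2 * deriv x t"
    by (rule generic_ball[OF A(1) ne mx eventually_conj[OF nz1 eventually_conj[OF nz2 eventually_conj[OF P eq]]]])
       (rule that, assumption+)
  have "chazy_system (ball c r) x (chazy4_inv x) (to_chazy6 x)"
    by (rule chazy4_imp_chazy_system[OF open_ball U(3)]) (use U(4) in blast)+
  then show ?thesis using that[OF U(1,2)] U(4) by blast
qed

lemma chazy6_solution_to_chazy6:
  assumes A: "open A" "connected A" and x: "chazy4_solution A x"
    and nv: "\<not> vanishes_identically A (to_chazy6_denom x)"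
  shows "chazy6_solution A (to_chazy6 x)"
proof -
  obtain c r where U: "r > 0" "ball c r \<subseteq> A"
    "chazy_system (ball c r) x (chazy4_inv x) (to_chazy6 x)"
    by (rule chazy4_generic_system[OF A x nv always_eventually]) auto
  show ?thesis
    using x U(1,2) chazy_system_chazy6[OF open_ball U(3)]
    by (intro chazy6_solutionI[OF A, of _ "ball c r"] meromorphic_intros)
       (auto simp: chazy4_solution_def)
qed

text \<open>If the denominator vanishes identically, then \<open>x'' = x x'\<close> and
  \<open>chazy4_inv x\<close> is \<open>x\<close> itself off a discrete set. Otherwise the quadratic
  system is available and its symmetry turns the result for \<open>x\<close> into one for
  \<open>v\<close>.\<close>

lemma chazy4_solution_chazy4_inv:
  assumes A: "open A" "connected A" and x: "chazy4_solution A x"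
    and nv: "\<not> vanishes_identically A (deriv x)"
  shows "chazy4_solution A (chazy4_inv x)"
proof (cases "vanishes_identically A (to_chazy6_denom x)")
  case True
  have mx: "x meromorphic_on A" using x by (simp add: chazy4_solution_def)
  have "\<forall>\<^sub>\<approx>t\<in>A. deriv x t \<noteq> 0"
    by (intro nonvanishing_imp_avoid A meromorphic_intros mx nv)
  with True have eq: "\<forall>\<^sub>\<approx>t\<in>A. chazy4_inv x t = x t"
    unfolding vanishes_identically_def
    by eventually_elim (auto simp: to_chazy6_denom_def chazy4_inv_def field_simps)
  note d1 = cosparse_deriv_cong[OF A(1) eq]
  note d2 = cosparse_deriv_cong[OF A(1) d1]
  note d3 = cosparse_deriv_cong[OF A(1) d2]
  from x have "\<forall>\<^sub>\<approx>t\<in>A. deriv (deriv (deriv x)) t =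
      3 * x t * deriv (deriv x) t + 3 * (deriv x t)^2 - 3 * (x t)^2 * deriv x t"
    by (simp add: chazy4_solution_def)
  with eq d1 d2 d3 have "\<forall>\<^sub>\<approx>t\<in>A. deriv (deriv (deriv (chazy4_inv x))) t =
      3 * chazy4_inv x t * deriv (deriv (chazy4_inv x)) t + 3 * (deriv (chazy4_inv x) t)^2
        - 3 * (chazy4_inv x t)^2 * deriv (chazy4_inv x) t"
    by eventually_elim simp
  then show ?thesis unfolding chazy4_solution_def by (intro conjI meromorphic_intros mx)
next
  case False
  obtain c r where U: "r > 0" "ball c r \<subseteq> A"
    "chazy_system (ball c r) x (chazy4_inv x) (to_chazy6 x)"
    by (rule chazy4_generic_system[OF A x False always_eventually]) auto
  show ?thesis
    using x U(1,2) chazy_system_chazy4[OF open_ball chazy_system_sym[OF U(3)]]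
    by (intro chazy4_solutionI[OF A, of _ "ball c r"] meromorphic_intros)
       (auto simp: chazy4_solution_def)
qed

text \<open>The swapped system has the same third component, so on a ball the formula applied to
  \<open>v\<close> returns the same \<open>y\<close>.\<close>

lemma to_chazy6_chazy4_inv:
  assumes A: "open A" "connected A" and x: "chazy4_solution A x"
    and nv: "\<not> vanishes_identically A (to_chazy6_denom x)"
      "\<not> vanishes_identically A (to_chazy6_denom (chazy4_inv x))"
  shows "\<forall>\<^sub>\<approx>t\<in>A. to_chazy6 (chazy4_inv x) t = to_chazy6 x t"
proof -
  have mx: "x meromorphic_on A" using x by (simp add: chazy4_solution_def)
  have den: "\<forall>\<^sub>\<approx>t\<in>A. to_chazy6_denom (chazy4_inv x) t \<noteq> 0"
    by (intro nonvanishing_imp_avoid A nv meromorphic_intros mx)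
  obtain c r where U: "r > 0" "ball c r \<subseteq> A"
    "chazy_system (ball c r) x (chazy4_inv x) (to_chazy6 x)"
    "\<And>t. t \<in> ball c r \<Longrightarrow> to_chazy6_denom (chazy4_inv x) t \<noteq> 0"
    by (rule chazy4_generic_system[OF A x nv(1) den]) (rule that, assumption+)
  show ?thesis
    using U chazy_system_to_chazy6[OF open_ball chazy_system_sym[OF U(3)]]
    by (intro identity_meromorphic[OF A, of _ _ "ball c r"] meromorphic_intros mx) auto
qed

subsection \<open>Meromorphic extension of local solutions\<close>

text \<open>The derivatives at the centre satisfy \<open>b (n + 3) = c * b n\<close> and grow at
  most geometrically, so the Taylor series converges everywhere.\<close>

lemma entire_extension_third_order:
  fixes u :: "complex \<Rightarrow> complex"
  assumes "r > 0" and hu: "u holomorphic_on ball a r"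
    and ode: "\<And>t. t \<in> ball a r \<Longrightarrow> deriv (deriv (deriv u)) t = c * u t"
  obtains g where "g holomorphic_on UNIV" "\<And>t. t \<in> ball a r \<Longrightarrow> g t = u t"
proof -
  define b where "b n = (deriv ^^ n) u a" for n
  have rec: "(deriv ^^ (n + 3)) u t = c * (deriv ^^ n) u t" if "t \<in> ball a r" for n t
    using that
  proof (induction n arbitrary: t)
    case 0
    then show ?case using ode by (simp add: eval_nat_numeral)
  next
    case (Suc n)
    have "(deriv ^^ n) u holomorphic_on ball a r"
      by (intro holomorphic_higher_deriv hu open_ball)
    then have "((deriv ^^ n) u has_field_derivative deriv ((deriv ^^ n) u) t) (at t)"
      using Suc.prems open_ball holomorphic_derivI by blast
    from deriv_eq_on_open[OF open_ball Suc.prems Suc.IH DERIV_cmult[OF this]]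
    have "deriv ((deriv ^^ (n + 3)) u) t = c * deriv ((deriv ^^ n) u) t" .
    then show ?case by (simp only: add_Suc funpow.simps o_apply)
  qed
  \<comment> \<open>With \<open>M\<close> at least 1, the factor \<open>c\<close> gained in three
    steps is bounded by \<open>M ^ 3\<close>, and the three initial values are bounded by
    \<open>K * M ^ n\<close>.\<close>
  define M where "M = max 1 (norm c)"
  define K where "K = norm (b 0) + norm (b 1) + norm (b 2)"
  have M: "M \<ge> 1" "norm c \<le> M" by (auto simp: M_def)
  have bound: "norm (b n) \<le> K * M ^ n" for n
  proof (induction n rule: less_induct)
    case (less n)
    show ?case
    proof (cases "n < 3")
      case True
      then have "n = 0 \<or> n = 1 \<or> n = 2" by auto
      then have "norm (b n) \<le> K" by (auto simp: K_def)
      also have "K * 1 \<le> K * M ^ n" using M by (intro mult_left_mono) (auto simp: K_def)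
      finally show ?thesis by simp
    next
      case False
      define k where "k = n - 3"
      have n: "n = k + 3" using False by (simp add: k_def)
      have "b n = c * b k"
        unfolding b_def n using \<open>r > 0\<close> by (intro rec) auto
      then have "norm (b n) = norm c * norm (b k)" by (simp add: norm_mult)
      also have "\<dots> \<le> M ^ 3 * (K * M ^ k)"
      proof (intro mult_mono less)
        have "M ^ 1 \<le> M ^ 3" using M by (intro power_increasing) auto
        then show "norm c \<le> M ^ 3" using M by simp
      qed (use M n in auto)
      finally show ?thesis by (simp add: n power_add mult_ac)
    qed
  qed
  define g where "g t = (\<Sum>n. b n / fact n * (t - a) ^ n)" for t
  have sums: "(\<lambda>n. b n / fact n * (t - a) ^ n) sums g t" for t
  proof -
    have "summable (\<lambda>n. K * (inverse (fact n) * (M * norm (t - a)) ^ n))"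
      by (intro summable_mult summable_exp)
    then have "summable (\<lambda>n. b n / fact n * (t - a) ^ n)"
    proof (rule summable_comparison_test')
      fix n
      have "norm (b n / fact n * (t - a) ^ n) = norm (b n) * (norm (t - a) ^ n / fact n)"
        by (simp add: norm_mult norm_divide norm_power)
      also have "\<dots> \<le> (K * M ^ n) * (norm (t - a) ^ n / fact n)"
        by (intro mult_right_mono bound) auto
      finally show "norm (b n / fact n * (t - a) ^ n)
          \<le> K * (inverse (fact n) * (M * norm (t - a)) ^ n)"
        by (simp add: power_mult_distrib field_simps)
    qed
    then show ?thesis unfolding g_def by (rule summable_sums)
  qed
  have "g holomorphic_on ball a R" for R
    by (rule power_series_holomorphic) (rule sums)
  then have "g field_differentiable at t" for t
    using holomorphic_on_imp_differentiable_at[of g "ball a (dist a t + 1)" t] by simp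
  then have "g holomorphic_on UNIV"
    by (simp add: holomorphic_on_def field_differentiable_at_within)
  moreover have "g t = u t" if "t \<in> ball a r" for t
    using sums_unique2[OF sums holomorphic_power_series[OF hu that, folded b_def]] .
  ultimately show ?thesis using that by blast
qed

text \<open>
  The substitution \<open>x = - u' / u\<close> linearises the Chazy IV equation to \<open>u''' = k u\<close>, where
  \<open>- k = x'' - 3 x x' + x\<^sup>3\<close> is a first integral.
\<close>

lemma chazy4_meromorphic_extension:
  assumes "r > 0" and hx: "x holomorphic_on ball a r"
    and eq: "\<And>t. t \<in> ball a r \<Longrightarrow> deriv (deriv (deriv x)) t =
      3 * x t * deriv (deriv x) t + 3 * (deriv x t)^2 - 3 * (x t)^2 * deriv x t"
  obtains z where "z meromorphic_on UNIV" "\<And>t. t \<in> ball a r \<Longrightarrow> z t = x t"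
proof -
  let ?U = "ball a r"
  have d: "(f has_field_derivative deriv f s) (at s)" if "f holomorphic_on ?U" "s \<in> ?U" for f s
    using that open_ball holomorphic_derivI by blast
  note h1 = holomorphic_deriv[OF hx open_ball] note h2 = holomorphic_deriv[OF h1 open_ball]
  note dx = d[OF hx] d[OF h1] d[OF h2]
  have "((\<lambda>t. deriv (deriv x) t - 3 * x t * deriv x t + x t ^ 3) has_field_derivative 0) (at s)"
    if s: "s \<in> ?U" for s
    by ((rule derivative_eq_intros dx[OF s] refl)+)
       (simp add: eq[OF s] power2_eq_square algebra_simps)
  then obtain k where k: "\<And>t. t \<in> ?U \<Longrightarrow> deriv (deriv x) t - 3 * x t * deriv x t + x t ^ 3 = - k"
    using has_field_derivative_zero_constant[OF convex_ball, of a r]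
    by (metis (no_types, lifting) has_field_derivative_at_within minus_minus)
  obtain G where G: "\<And>t. t \<in> ?U \<Longrightarrow> (G has_field_derivative x t) (at t within ?U)"
    using holomorphic_convex_primitive'[OF convex_ball open_ball hx] by blast
  have G': "(G has_field_derivative x t) (at t)" if "t \<in> ?U" for t
    using G[OF that] at_within_open[OF that open_ball] by simp
  \<comment> \<open>As the exponential of minus a primitive of \<open>x\<close>, \<open>u\<close>
    has no zeros on the ball and satisfies \<open>- u' / u = x\<close>.\<close>
  define u where "u t = exp (- G t)" for t
  have du: "(u has_field_derivative - x t * u t) (at t)" if "t \<in> ?U" for t
    unfolding u_def by (rule derivative_eq_intros G'[OF that] refl)+ simp
  have u1: "deriv u t = - x t * u t" if "t \<in> ?U" for t
    using du[OF that] by (rule DERIV_imp_deriv)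
  have u2: "deriv (deriv u) t = ((x t)^2 - deriv x t) * u t" if t: "t \<in> ?U" for t
    by (rule deriv_eq_on_open[OF open_ball t u1], assumption)
       ((rule derivative_eq_intros dx[OF t] du[OF t] refl)+, simp add: algebra_simps power2_eq_square)
  have u3: "deriv (deriv (deriv u)) t = k * u t" if t: "t \<in> ?U" for t
  proof -
    have "deriv (deriv (deriv u)) t = - (deriv (deriv x) t - 3 * x t * deriv x t + x t ^ 3) * u t"
      by (rule deriv_eq_on_open[OF open_ball t u2], assumption)
         ((rule derivative_eq_intros dx[OF t] du[OF t] refl)+,
          simp add: algebra_simps power2_eq_square power3_eq_cube)
    then show ?thesis unfolding k[OF t] by simp
  qed
  have hu: "u holomorphic_on ?U" using du unfolding holomorphic_on_open[OF open_ball] by blast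
  obtain g where g: "g holomorphic_on UNIV" "\<And>t. t \<in> ?U \<Longrightarrow> g t = u t"
    using entire_extension_third_order[OF \<open>r > 0\<close> hu u3] by blast
  have "g meromorphic_on UNIV"
    using g(1) by (simp add: analytic_on_imp_meromorphic_on analytic_on_open)
  \<comment> \<open>The entire function \<open>g\<close> may vanish outside the ball, so the
    extension of \<open>x\<close> is only meromorphic.\<close>
  then have "(\<lambda>t. - deriv g t / g t) meromorphic_on UNIV" by (intro meromorphic_intros)
  moreover have "- deriv g t / g t = x t" if "t \<in> ?U" for t
  proof -
    have "deriv g t = - x t * u t"
      by (rule deriv_eq_on_open[OF open_ball that g(2) du[OF that]])
    then show ?thesis using g(2)[OF that] by (simp add: u_def)
  qed
  ultimately show ?thesis using that by blast
qed

lemma chazy_system_cong: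
  assumes "open U" "chazy_system U x v y" "\<And>t. t \<in> U \<Longrightarrow> z t = x t"
  shows "chazy_system U z v y"
  unfolding chazy_system_def
proof (intro ballI)
  fix t assume t: "t \<in> U"
  note s = assms(2)[unfolded chazy_system_def, rule_format, OF t]
  have "(z has_field_derivative (x t * (2 * x t - v t) - y t * (x t - v t)) / 2) (at t)"
    by (rule has_field_derivative_transform_within_open[OF conjunct1[OF s] assms(1) t])
       (simp add: assms(3))
  with s show "(z has_field_derivative (z t * (2 * z t - v t) - y t * (z t - v t)) / 2) (at t) \<and>
     (v has_field_derivative (v t * (2 * v t - z t) - y t * (v t - z t)) / 2) (at t) \<and>
     (y has_field_derivative (3 * z t * v t - 3 * y t * (z t + v t) + 2 * (y t)^2) / 2) (at t)"
    unfolding assms(3)[OF t] by blast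
qed

text \<open>Only \<open>x\<close> has to be extended, because \<open>to_chazy6 z\<close> is built
  from \<open>z\<close> alone; \<open>v\<close> stays a local function. The extension lives on the
  whole plane, so the topology of \<open>A\<close> causes no obstruction.\<close>

lemma chazy_system_global:
  assumes A: "open A" "connected A" and y: "y meromorphic_on A"
    and r: "r > 0" "ball a r \<subseteq> A" and sys: "chazy_system (ball a r) x v y"
    and ne: "\<And>t. t \<in> ball a r \<Longrightarrow> x t \<noteq> v t"
    and t0: "t0 \<in> ball a r" "deriv x t0 \<noteq> 0"
  shows "\<exists>z. chazy4_solution A z \<and> \<not> vanishes_identically A (to_chazy6_denom z) \<and>
             (\<forall>\<^sub>\<approx>t\<in>A. y t = to_chazy6 z t)"
proof -
  let ?U = "ball a r"
  have hx: "x holomorphic_on ?U"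
    using sys by (auto simp: holomorphic_on_open chazy_system_def)
  obtain z where z: "z meromorphic_on UNIV" "\<And>t. t \<in> ?U \<Longrightarrow> z t = x t"
    using chazy4_meromorphic_extension[OF r(1) hx chazy_system_chazy4[OF open_ball sys]] by blast
  have sysz: "chazy_system ?U z v y" by (rule chazy_system_cong[OF open_ball sys z(2)])
  have hz: "z holomorphic_on ?U" using z(2) by (intro holomorphic_transform[OF hx]) auto
  have mz: "z meromorphic_on A" using z(1) by (rule meromorphic_on_subset) simp
  \<comment> \<open>On this open set the denominator \<open>(z - v) z'\<close> has no zeros, so
    \<open>y\<close> is given there by the formula.\<close>
  define W where "W = {t \<in> ?U. deriv z t \<noteq> 0}"
  have "open W"
  proof -
    have "continuous_on ?U (deriv z)"
      by (intro holomorphic_on_imp_continuous_on holomorphic_deriv hz open_ball)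
    from continuous_open_preimage[OF this open_ball, of "- {0}"] show ?thesis
      unfolding W_def by (simp add: vimage_def Int_def open_Compl)
  qed
  have WU: "W \<subseteq> ?U" by (auto simp: W_def)
  have "deriv z t0 = deriv x t0"
    by (rule deriv_eq_on_open[OF open_ball t0(1) z(2)])
       (use hx t0(1) open_ball holomorphic_derivI in blast)+
  then have "W \<noteq> {}" using t0 by (auto simp: W_def)
  have den: "to_chazy6_denom z t \<noteq> 0" if "t \<in> W" for t
    using that chazy_system_denom[OF open_ball sysz, of t] ne z(2) by (auto simp: W_def)
  have sol: "y t = to_chazy6 z t" if "t \<in> W" for t
    using chazy_system_to_chazy6[OF open_ball sysz _ den[OF that]] that WU by auto
  show ?thesis
  proof (intro exI conjI)
    show "chazy4_solution A z"
      by (rule chazy4_solutionI[OF A mz open_ball _ r(2) chazy_system_chazy4[OF open_ball sysz]])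
         (use r in auto)
    show "\<not> vanishes_identically A (to_chazy6_denom z)"
      using WU r(2) by (intro nonvanishingI[OF A(1) \<open>open W\<close> \<open>W \<noteq> {}\<close> _ den]) auto
    show "\<forall>\<^sub>\<approx>t\<in>A. y t = to_chazy6 z t"
      using WU r(2) by (intro identity_meromorphic[OF A y _ \<open>open W\<close> \<open>W \<noteq> {}\<close> _ sol]
        meromorphic_intros mz) auto
  qed
qed

subsection \<open>Recovering a Chazy IV solution from a Chazy VI solution\<close>

text \<open>
  Recovers the sum \<open>s = x + v\<close> and the product \<open>p = x v\<close> from \<open>y\<close>: the relations for \<open>y'\<close> and
  \<open>y''\<close> in \<open>chazy_system\<close> are linear in \<open>s\<close> and \<open>p\<close>.
\<close>

definition chazy6_sum :: "(complex \<Rightarrow> complex) \<Rightarrow> complex \<Rightarrow> complex" where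
  "chazy6_sum y t = (3 * y t * deriv y t - (y t)^3 - deriv (deriv y) t) / (deriv y t - (y t)^2)"

definition chazy6_prod :: "(complex \<Rightarrow> complex) \<Rightarrow> complex \<Rightarrow> complex" where
  "chazy6_prod y t = (2 * (deriv y t - (y t)^2) + 3 * y t * chazy6_sum y t) / 3"

text \<open>This is the system for \<open>x\<close> and \<open>v\<close> in terms of their
  elementary symmetric functions, derived from Chazy VI alone, before any roots are chosen.\<close>

lemma chazy6_sum_prod_derivs:
  assumes U: "open U" and hy: "y holomorphic_on U" and t: "t \<in> U"
    and eq: "deriv (deriv (deriv y)) t =
      y t * deriv (deriv y) t + 5 * (deriv y t)^2 - (y t)^2 * deriv y t"
    and nz: "deriv y t \<noteq> (y t)^2"
  defines "s \<equiv> chazy6_sum y" and "p \<equiv> chazy6_prod y"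
  shows "(s has_field_derivative (s t)^2 - 3 * p t) (at t)"
    and "(p has_field_derivative (p t * s t + y t * ((s t)^2 - 4 * p t)) / 2) (at t)"
proof -
  note h1 = holomorphic_deriv[OF hy U] note h2 = holomorphic_deriv[OF h1 U]
  have d: "(f has_field_derivative deriv f t) (at t)" if "f holomorphic_on U" for f
    using that t U holomorphic_derivI by blast
  note dy = d[OF hy] d[OF h1] d[OF h2, unfolded eq]
  have nz': "deriv y t - (y t)^2 \<noteq> 0" using nz by simp
  have s: "s t * (deriv y t - (y t)^2) = 3 * y t * deriv y t - (y t)^3 - deriv (deriv y) t"
    using nz' by (simp add: s_def chazy6_sum_def)
  have p: "3 * p t = 2 * (deriv y t - (y t)^2) + 3 * y t * s t"
    by (simp add: p_def chazy6_prod_def s_def)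
  let ?B1 = "deriv (deriv y) t - 2 * y t * deriv y t"
  let ?C = "3 * y t * deriv y t - (y t)^3 - deriv (deriv y) t"
  let ?C1 = "3 * (deriv y t)^2 + 3 * y t * deriv (deriv y) t - 3 * (y t)^2 * deriv y t
    - (y t * deriv (deriv y) t + 5 * (deriv y t)^2 - (y t)^2 * deriv y t)"
  have "(s has_field_derivative (?C1 * (deriv y t - (y t)^2) - ?C * ?B1)
      / ((deriv y t - (y t)^2) * (deriv y t - (y t)^2))) (at t)"
    unfolding s_def chazy6_sum_def[abs_def]
  proof (rule DERIV_divide)
    show "((\<lambda>t. 3 * y t * deriv y t - (y t)^3 - deriv (deriv y) t) has_field_derivative ?C1) (at t)"
      "((\<lambda>t. deriv y t - (y t)^2) has_field_derivative ?B1) (at t)"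
      by ((rule derivative_eq_intros dy refl)+, simp add: algebra_simps power2_eq_square)+
  qed (rule nz')
  also have "?C1 * (deriv y t - (y t)^2) - ?C * ?B1
      = ((s t)^2 - 3 * p t) * ((deriv y t - (y t)^2) * (deriv y t - (y t)^2))"
    using s p by algebra
  finally show ds: "(s has_field_derivative (s t)^2 - 3 * p t) (at t)"
    using nz' by simp
  have pf: "p = (\<lambda>t. (2 * (deriv y t - (y t)^2) + 3 * y t * s t) / 3)"
    by (simp add: fun_eq_iff p_def chazy6_prod_def s_def)
  have "((\<lambda>t. (2 * (deriv y t - (y t)^2) + 3 * y t * s t) / 3) has_field_derivative (2 * ?B1 + (3 * deriv y t * s t + 3 * y t * ((s t)^2 - 3 * p t))) / 3) (at t)"
    by (rule DERIV_cdivide)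
       ((rule derivative_eq_intros dy ds refl)+, simp add: algebra_simps power2_eq_square)
  also have "(2 * ?B1 + (3 * deriv y t * s t + 3 * y t * ((s t)^2 - 3 * p t))) / 3
      = (p t * s t + y t * ((s t)^2 - 4 * p t)) / 2"
  proof -
    have "2 * (2 * ?B1 + (3 * deriv y t * s t + 3 * y t * ((s t)^2 - 3 * p t)))
        = 3 * (p t * s t + y t * ((s t)^2 - 4 * p t))"
      using s p by algebra
    moreover have "a / 3 = b / 2" if "2 * a = 3 * b" for a b :: complex
      using that by (simp add: frac_eq_eq mult.commute)
    ultimately show ?thesis by blast
  qed
  finally show "(p has_field_derivative (p t * s t + y t * ((s t)^2 - 4 * p t)) / 2) (at t)"
    unfolding pf[symmetric] .
qed

text \<open>Given a square root \<open>q\<close> of the discriminant, differentiating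
  \<open>q^2 = s^2 - 4 p\<close> and cancelling \<open>2 q\<close> gives
  \<open>q' = (s - y) q\<close>. Together with \<open>s'\<close> this yields the equations for the
  two roots.\<close>

lemma chazy_system_of_sqrt:
  assumes U: "open U" and hy: "y holomorphic_on U"
    and eq: "\<And>t. t \<in> U \<Longrightarrow> deriv (deriv (deriv y)) t =
      y t * deriv (deriv y) t + 5 * (deriv y t)^2 - (y t)^2 * deriv y t"
    and nz: "\<And>t. t \<in> U \<Longrightarrow> deriv y t \<noteq> (y t)^2"
    and hq: "q holomorphic_on U"
    and q2: "\<And>t. t \<in> U \<Longrightarrow> (q t)^2 = (chazy6_sum y t)^2 - 4 * chazy6_prod y t"
    and q0: "\<And>t. t \<in> U \<Longrightarrow> q t \<noteq> 0"
  shows "chazy_system U (\<lambda>t. (chazy6_sum y t + q t) / 2) (\<lambda>t. (chazy6_sum y t - q t) / 2) y"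
  unfolding chazy_system_def
proof (intro ballI conjI)
  fix t assume t: "t \<in> U"
  define s where "s = chazy6_sum y"
  define p where "p = chazy6_prod y"
  have ds: "(s has_field_derivative (s t)^2 - 3 * p t) (at t)"
    and dp: "(p has_field_derivative (p t * s t + y t * ((s t)^2 - 4 * p t)) / 2) (at t)"
    using chazy6_sum_prod_derivs[OF U hy t eq[OF t] nz[OF t]] unfolding s_def p_def by blast+
  have dq: "(q has_field_derivative deriv q t) (at t)"
    using hq t U holomorphic_derivI by blast
  have dy: "(y has_field_derivative deriv y t) (at t)"
    using hy t U holomorphic_derivI by blast
  have q2: "(q t)^2 = (s t)^2 - 4 * p t" if "t \<in> U" for t
    using q2[OF that] by (simp add: s_def p_def)
  have "((\<lambda>t. (s t)^2 - 4 * p t) has_field_derivative 2 * q t * deriv q t) (at t)"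
    by (rule has_field_derivative_transform_within_open[OF _ U t q2])
       ((rule derivative_eq_intros dq refl)+, simp_all)
  moreover define p1 where "p1 = (p t * s t + y t * ((s t)^2 - 4 * p t)) / 2"
  have p1: "2 * p1 = p t * s t + y t * ((s t)^2 - 4 * p t)"
    using p1_def unfolding eq_half_iff .
  have "((\<lambda>t. (s t)^2 - 4 * p t) has_field_derivative
      2 * s t * ((s t)^2 - 3 * p t) - 4 * p1) (at t)"
    by ((rule derivative_eq_intros ds dp[folded p1_def] refl)+, simp)
  ultimately have "2 * q t * deriv q t = 2 * s t * ((s t)^2 - 3 * p t) - 4 * p1"
    by (rule DERIV_unique)
  then have "2 * q t * deriv q t = 2 * q t * ((s t - y t) * q t)"
    using q2[OF t] p1 by algebra
  then have q1: "deriv q t = (s t - y t) * q t" using q0[OF t] by simp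
  let ?x = "(s t + q t) / 2" and ?v = "(s t - q t) / 2"
  have sx: "s t = ?x + ?v" and qx: "q t = ?x - ?v" by (simp_all add: field_simps)
  have px: "p t = ?x * ?v"
  proof -
    have "4 * p t = (s t)^2 - (q t)^2" using q2[OF t] by algebra
    also have "\<dots> = 4 * (?x * ?v)" by (simp add: field_simps power2_eq_square)
    finally show ?thesis by (simp only: mult_cancel_left) simp
  qed
  \<comment> \<open>The roots are treated as free variables here, which keeps the halves out of the
    polynomial identities.\<close>
  have sqp: "S^2 - 3 * P + (S - Y) * Q = X * (2 * X - V) - Y * (X - V)"
    "S^2 - 3 * P - (S - Y) * Q = V * (2 * V - X) - Y * (V - X)"
    if "S = X + V" "Q = X - V" "P = X * V" for S P Q X V Y :: complex
    using that by algebra+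
  have "((\<lambda>t. (s t + q t) / 2) has_field_derivative ((s t)^2 - 3 * p t + (s t - y t) * q t) / 2) (at t)"
    by (rule DERIV_cdivide DERIV_add ds dq[unfolded q1])+
  also have "(s t)^2 - 3 * p t + (s t - y t) * q t = ?x * (2 * ?x - ?v) - y t * (?x - ?v)"
    by (rule sqp(1)[OF sx qx px])
  finally show "((\<lambda>t. (chazy6_sum y t + q t) / 2) has_field_derivative
    ((chazy6_sum y t + q t) / 2 * (2 * ((chazy6_sum y t + q t) / 2) - (chazy6_sum y t - q t) / 2) -
     y t * ((chazy6_sum y t + q t) / 2 - (chazy6_sum y t - q t) / 2)) / 2) (at t)"
    unfolding s_def .
  have "((\<lambda>t. (s t - q t) / 2) has_field_derivative ((s t)^2 - 3 * p t - (s t - y t) * q t) / 2) (at t)"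
    by (rule DERIV_cdivide DERIV_diff ds dq[unfolded q1])+
  also have "(s t)^2 - 3 * p t - (s t - y t) * q t = ?v * (2 * ?v - ?x) - y t * (?v - ?x)"
    by (rule sqp(2)[OF sx qx px])
  finally show "((\<lambda>t. (chazy6_sum y t - q t) / 2) has_field_derivative
    ((chazy6_sum y t - q t) / 2 * (2 * ((chazy6_sum y t - q t) / 2) - (chazy6_sum y t + q t) / 2) -
     y t * ((chazy6_sum y t - q t) / 2 - (chazy6_sum y t + q t) / 2)) / 2) (at t)"
    unfolding s_def .
  have "3 * p t = 2 * (deriv y t - (y t)^2) + 3 * y t * s t"
    by (simp add: p_def chazy6_prod_def s_def)
  then have "2 * deriv y t = 3 * p t - 3 * y t * s t + 2 * (y t)^2" by algebra
  also have "3 * p t - 3 * y t * s t = 3 * ?x * ?v - 3 * y t * (?x + ?v)"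
    unfolding px sx[symmetric] by (simp only: mult.assoc)
  finally have "2 * deriv y t = 3 * ?x * ?v - 3 * y t * (?x + ?v) + 2 * (y t)^2" .
  with dy show "(y has_field_derivative
     (3 * ((chazy6_sum y t + q t) / 2) * ((chazy6_sum y t - q t) / 2) -
      3 * y t * ((chazy6_sum y t + q t) / 2 + (chazy6_sum y t - q t) / 2) + 2 * (y t)^2) / 2) (at t)"
    unfolding s_def eq_half_iff[symmetric] by (simp only:)
qed

section \<open>Degenerate cases: constant roots, a double root, and \<open>y' = y^2\<close>\<close>

lemma DERIV_zero_ball_const:
  assumes "\<And>t. t \<in> ball a r \<Longrightarrow> (f has_field_derivative 0) (at t)"
  obtains k where "\<And>t. t \<in> ball a r \<Longrightarrow> f t = k"
proof -
  have "\<exists>k. \<forall>t\<in>ball a r. f t = k"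
    by (rule has_field_derivative_zero_constant[OF convex_ball])
       (rule has_field_derivative_at_within, rule assms)
  then show ?thesis using that by blast
qed

text \<open>With both roots constant and distinct, the equation for \<open>x'\<close> determines
  \<open>y\<close> as a constant, which is nonzero because \<open>y'\<close> differs from
  \<open>y^2\<close>.\<close>

lemma chazy6_constant_exceptional:
  assumes A: "open A" "connected A" and y: "y meromorphic_on A"
    and r: "r > 0" "ball a r \<subseteq> A" and sys: "chazy_system (ball a r) x v y"
    and ne: "\<And>t. t \<in> ball a r \<Longrightarrow> x t \<noteq> v t"
    and nz: "\<And>t. t \<in> ball a r \<Longrightarrow> deriv y t \<noteq> (y t)^2"
    and const: "\<And>t. t \<in> ball a r \<Longrightarrow> deriv x t = 0" "\<And>t. t \<in> ball a r \<Longrightarrow> deriv v t = 0"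
  shows "chazy6_exceptional A y"
proof -
  let ?U = "ball a r"
  note d = sys[unfolded chazy_system_def, rule_format]
  have dx: "(x has_field_derivative 0) (at t)" and dv: "(v has_field_derivative 0) (at t)" if "t \<in> ?U" for t
    using d[OF that] const[OF that] DERIV_imp_deriv by metis+
  obtain k where k: "\<And>t. t \<in> ?U \<Longrightarrow> x t = k" by (rule DERIV_zero_ball_const[OF dx]) auto
  obtain l where l: "\<And>t. t \<in> ?U \<Longrightarrow> v t = l" by (rule DERIV_zero_ball_const[OF dv]) auto
  have "y t = k * (2 * k - l) / (k - l)" if "t \<in> ?U" for t
    using chazy_system_deriv[OF open_ball sys that] const(1)[OF that] ne[OF that]
    by (simp add: k[OF that] l[OF that] field_simps)
  then obtain m where m: "\<And>t. t \<in> ?U \<Longrightarrow> y t = m" by blast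
  have "deriv y a = 0"
    by (rule deriv_eq_on_open[OF open_ball _ m DERIV_const]) (use r in auto)
  then have "m \<noteq> 0" using nz[of a] m[of a] r by auto
  moreover have "\<forall>\<^sub>\<approx>t\<in>A. y t = m"
    by (rule identity_meromorphic[OF A y _ open_ball _ r(2) m]) (use r in auto)
  ultimately show ?thesis unfolding chazy6_exceptional_def by blast
qed

text \<open>The roots coincide, and \<open>s' = s^2 - 3 p\<close> becomes
  \<open>x' = x^2 / 2\<close>, so \<open>x = - 2 / (t - a)\<close>. The relation for
  \<open>y'\<close> then turns into an explicitly solvable Riccati equation.\<close>

lemma chazy6_double_root_exceptional:
  assumes A: "open A" "connected A" and y: "y meromorphic_on A"
    and r: "r > 0" "ball c r \<subseteq> A" and hy: "y holomorphic_on ball c r"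
    and eq: "\<And>t. t \<in> ball c r \<Longrightarrow> deriv (deriv (deriv y)) t =
      y t * deriv (deriv y) t + 5 * (deriv y t)^2 - (y t)^2 * deriv y t"
    and nz: "\<And>t. t \<in> ball c r \<Longrightarrow> deriv y t \<noteq> (y t)^2"
    and disc: "\<And>t. t \<in> ball c r \<Longrightarrow> (chazy6_sum y t)^2 = 4 * chazy6_prod y t"
  shows "chazy6_exceptional A y"
proof -
  let ?U = "ball c r"
  define x where "x t = chazy6_sum y t / 2" for t
  have p: "chazy6_prod y t = (x t)^2" if "t \<in> ?U" for t
    using disc[OF that] by (simp add: x_def power2_eq_square)
  have dx: "(x has_field_derivative (x t)^2 / 2) (at t)" if t: "t \<in> ?U" for t
  proof -
    have "((\<lambda>t. chazy6_sum y t / 2) has_field_derivative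
        ((chazy6_sum y t)^2 - 3 * chazy6_prod y t) / 2) (at t)"
      by (intro DERIV_cdivide chazy6_sum_prod_derivs(1)[OF open_ball hy t eq[OF t] nz[OF t]])
    also have "(chazy6_sum y t)^2 - 3 * chazy6_prod y t = (x t)^2"
      using disc[OF t] p[OF t] by simp
    finally show ?thesis unfolding x_def [abs_def] .
  qed
  have B: "2 * (deriv y t - (y t)^2) = 3 * (x t)^2 - 6 * x t * y t" if "t \<in> ?U" for t
    using p[OF that] by (simp add: x_def chazy6_prod_def field_simps)
  have x0: "x t \<noteq> 0" if "t \<in> ?U" for t
    using B[OF that] nz[OF that] by auto
  have "((\<lambda>t. 2 / x t + t) has_field_derivative 0) (at t)" if t: "t \<in> ?U" for t
    using x0[OF t] by (auto intro!: derivative_eq_intros dx[OF t] simp: power2_eq_square)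
  then obtain a where a: "\<And>t. t \<in> ?U \<Longrightarrow> 2 / x t + t = a"
    using DERIV_zero_ball_const[of c r "\<lambda>t. 2 / x t + t"] by blast
  have ta: "t - a \<noteq> 0" and xt: "x t * (t - a) = - 2" if "t \<in> ?U" for t
    using a[OF that] x0[OF that] by (auto simp: field_simps)
  \<comment> \<open>With \<open>\<tau> = t - a\<close>, \<open>y\<close> solves the Riccati equation \<open>\<tau>\<^sup>2 y' = \<tau>\<^sup>2 y\<^sup>2 + 6 \<tau> y + 6\<close>, which has the
    particular solution \<open>- 1 / \<tau>\<close>; \<open>z\<close> is the deviation from it, and \<open>m\<close> below a first integral.\<close>
  define z where "z t = y t * (t - a) + 1" for t
  have dy: "(y has_field_derivative deriv y t) (at t)" if "t \<in> ?U" for t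
    using hy that open_ball holomorphic_derivI by blast
  have y1: "deriv y t * (t - a)^2 = (y t * (t - a))^2 + 6 * z t" if t: "t \<in> ?U" for t
  proof -
    have "2 * (deriv y t * (t - a)^2) = 2 * ((y t * (t - a))^2 + 6 * z t)"
      using B[OF t] xt[OF t] unfolding z_def by algebra
    then show ?thesis by (simp only: mult_cancel_left) simp
  qed
  \<comment> \<open>A zero of \<open>z\<close> would give \<open>y' = y^2\<close> at that
    point.\<close>
  have z0: "z t \<noteq> 0" if t: "t \<in> ?U" for t
  proof
    assume "z t = 0"
    then have "(deriv y t - (y t)^2) * (t - a)^2 = 0" using y1[OF t] by algebra
    then show False using nz[OF t] ta[OF t] by simp
  qed
  have dz: "(z has_field_derivative deriv y t * (t - a) + y t) (at t)" if t: "t \<in> ?U" for t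
    unfolding z_def[abs_def] by ((rule derivative_eq_intros dy[OF t] refl)+, simp)
  have "((\<lambda>t. (t - a)^5 + 5 * (t - a)^5 / z t) has_field_derivative 0) (at t)" if t: "t \<in> ?U" for t
  proof -
    have "((\<lambda>t. (t - a)^5 + 5 * (t - a)^5 / z t) has_field_derivative
       5 * (t - a)^4 + (25 * (t - a)^4 * z t - 5 * (t - a)^5 * (deriv y t * (t - a) + y t)) / (z t * z t)) (at t)"
      by ((rule derivative_eq_intros dz[OF t] z0[OF t] refl)+, simp add: algebra_simps)
    also have "25 * (t - a)^4 * z t - 5 * (t - a)^5 * (deriv y t * (t - a) + y t) = - (5 * (t - a)^4) * (z t * z t)"
      using y1[OF t] unfolding z_def by algebra
    finally show ?thesis using z0[OF t] by simp
  qed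
  then obtain m where m: "\<And>t. t \<in> ?U \<Longrightarrow> (t - a)^5 + 5 * (t - a)^5 / z t = m"
    using DERIV_zero_ball_const[of c r "\<lambda>t. (t - a)^5 + 5 * (t - a)^5 / z t"] by blast
  have "y t = - (6 * (t - a)^5 - m) / ((t - a)^6 - m * (t - a))" if t: "t \<in> ?U" for t
  proof -
    have "5 * (t - a)^5 = (m - (t - a)^5) * z t"
      using m[OF t] z0[OF t] by (simp add: field_simps)
    then have *: "y t * ((t - a)^6 - m * (t - a)) = - (6 * (t - a)^5 - m)"
      and **: "(t - a) * (5 * (t - a)^5) + ((t - a)^6 - m * (t - a)) * z t = 0"
      unfolding z_def by algebra+
    have "(t - a)^6 - m * (t - a) \<noteq> 0"
    proof
      assume "(t - a)^6 - m * (t - a) = 0"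
      with ** have "(t - a) * (5 * (t - a)^5) = 0" by simp
      with ta[OF t] show False by simp
    qed
    with * show ?thesis by (simp add: eq_divide_eq)
  qed
  then have "\<forall>\<^sub>\<approx>t\<in>A. y t = - (6 * (t - a)^5 - m) / ((t - a)^6 - m * (t - a))"
    by (intro identity_meromorphic[OF A y _ open_ball _ r(2)] meromorphic_intros) (use r in auto)
  then show ?thesis unfolding chazy6_exceptional_def by blast
qed

text \<open>
  Solutions of \<open>y' = y\<^sup>2\<close>, that is \<open>y = 0\<close> or \<open>y = - 1 / (t - a)\<close>, come from \<open>x = - u' / u\<close> with
  a polynomial \<open>u\<close> of degree at most two: \<open>u = t - b\<close> or \<open>u = (t - a)\<^sup>2 - k\<close>.
\<close>

lemma chazy6_obtained_riccati:
  assumes A: "open A" "connected A" and y: "y meromorphic_on A"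
    and r: "r > 0" "ball c r \<subseteq> A" and hy: "y holomorphic_on ball c r"
    and ric: "\<And>t. t \<in> ball c r \<Longrightarrow> deriv y t = (y t)^2"
    and zero: "(\<forall>t\<in>ball c r. y t = 0) \<or> (\<forall>t\<in>ball c r. y t \<noteq> 0)"
  shows "\<exists>z. chazy4_solution A z \<and> \<not> vanishes_identically A (to_chazy6_denom z) \<and>
             (\<forall>\<^sub>\<approx>t\<in>A. y t = to_chazy6 z t)"
proof -
  let ?U = "ball c r"
  have cU: "c \<in> ?U" using r by simp
  have dy: "(y has_field_derivative (y t)^2) (at t)" if "t \<in> ?U" for t
    using hy that open_ball holomorphic_derivI ric by metis
  from zero show ?thesis
  proof
    assume y0: "\<forall>t\<in>?U. y t = 0"
    \<comment> \<open>Any point outside the open ball would do; this one lies on its boundary. The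
      partner of \<open>x = - 1 / (t - b)\<close> is \<open>v = 0\<close>.\<close>
    define b where "b = c + of_real r"
    have tb: "t - b \<noteq> 0" if "t \<in> ?U" for t
      using that r by (auto simp: b_def dist_norm)
    define x where "x t = - 1 / (t - b)" for t
    have dx: "(x has_field_derivative (x t)^2) (at t)" if "t \<in> ?U" for t
      unfolding x_def using tb[OF that]
      by (auto intro!: derivative_eq_intros simp: power2_eq_square)
    have sys: "chazy_system ?U x (\<lambda>_. 0) y"
      unfolding chazy_system_def using y0 dx dy
      by (fastforce simp: power2_eq_square)
    have "deriv x c \<noteq> 0"
      using DERIV_imp_deriv[OF dx[OF cU]] tb[OF cU] by (simp add: x_def)
    then show ?thesis
      by (intro chazy_system_global[OF A y r sys _ cU]) (use tb in \<open>auto simp: x_def\<close>)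
  next
    assume y0: "\<forall>t\<in>?U. y t \<noteq> 0"
    have "((\<lambda>t. 1 / y t + t) has_field_derivative 0) (at t)" if t: "t \<in> ?U" for t
      using y0 t by (auto intro!: derivative_eq_intros dy[OF t] simp: power2_eq_square)
    then obtain a where a: "\<And>t. t \<in> ?U \<Longrightarrow> 1 / y t + t = a"
      using DERIV_zero_ball_const[of c r "\<lambda>t. 1 / y t + t"] by blast
    have ta: "t - a \<noteq> 0" and yt: "y t = - 1 / (t - a)" if "t \<in> ?U" for t
    proof -
      have "y t * (1 / y t + t) = y t * a" using a[OF that] by simp
      then have *: "y t * (t - a) = - 1" using y0 that by (simp add: algebra_simps)
      then show "t - a \<noteq> 0" by auto
      with * show "y t = - 1 / (t - a)" by (simp only: eq_divide_eq) simp
    qed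
    \<comment> \<open>Chosen larger in modulus than \<open>(t - a)^2\<close> on the ball, so that
      neither \<open>(t - a)^2 - k\<close> nor \<open>(t - a)^2 + k\<close> has a zero
      there.\<close>
    define k :: complex where "k = of_real ((norm (c - a) + r)^2)"
    have k: "(t - a)^2 - k \<noteq> 0" "(t - a)^2 + k \<noteq> 0" if "t \<in> ?U" for t
    proof -
      have "norm (t - a) \<le> norm (c - a) + norm (t - c)"
        using norm_triangle_ineq[of "c - a" "t - c"] by simp
      also have "norm (t - c) < r" using that by (simp add: dist_norm norm_minus_commute)
      finally have "norm (t - a) ^ 2 < (norm (c - a) + r)^2"
        by (intro power_strict_mono) auto
      then have lt: "norm ((t - a)^2) < norm k" unfolding k_def norm_of_real norm_power by simp
      then show "(t - a)^2 - k \<noteq> 0" by auto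
      show "(t - a)^2 + k \<noteq> 0"
      proof
        assume "(t - a)^2 + k = 0"
        then have "(t - a)^2 = - k" by (simp add: eq_neg_iff_add_eq_0)
        with lt show False by simp
      qed
    qed
    have k0: "k \<noteq> 0"
    proof -
      have "norm (c - a) + r \<noteq> 0" using r norm_ge_zero[of "c - a"] by linarith
      then show ?thesis unfolding k_def of_real_eq_0_iff by simp
    qed
    \<comment> \<open>The pair of Chazy IV solutions is \<open>x k\<close> and
      \<open>x (- k)\<close>. With \<open>l\<close> as a parameter, one computation serves both
      equations.\<close>
    define x where "x l t = - 2 * (t - a) / ((t - a)^2 - l)" for l t
    have dx: "(x l has_field_derivative 2 * ((t - a)^2 + l) / ((t - a)^2 - l)^2) (at t)"
      if "(t - a)^2 - l \<noteq> 0" for l t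
    proof -
      have "(x l has_field_derivative
          (- 2 * ((t - a)^2 - l) - - 2 * (t - a) * (2 * (t - a))) / (((t - a)^2 - l) * ((t - a)^2 - l))) (at t)"
        unfolding x_def[abs_def]
      proof (rule DERIV_divide)
        show "((\<lambda>t. - 2 * (t - a)) has_field_derivative - 2) (at t)"
          "((\<lambda>t. (t - a)^2 - l) has_field_derivative 2 * (t - a)) (at t)"
          by ((rule derivative_eq_intros refl)+, simp)+
      qed (rule that)
      also have "- 2 * ((t - a)^2 - l) - - 2 * (t - a) * (2 * (t - a)) = 2 * ((t - a)^2 + l)"
        by algebra
      finally show ?thesis by (simp only: power2_eq_square)
    qed
    have yt': "y t * (t - a) = - 1" if "t \<in> ?U" for t
      using yt[OF that] ta[OF that] by simp
    have xe: "x l t * ((t - a)^2 - l) = - 2 * (t - a)" if "(t - a)^2 - l \<noteq> 0" for l t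
      using that by (simp add: x_def)
    have rel: "2 * ((t - a)^2 + l) / ((t - a)^2 - l)^2
        = (x l t * (2 * x l t - x (- l) t) - y t * (x l t - x (- l) t)) / 2"
      if nz: "(t - a)^2 - l \<noteq> 0" "(t - a)^2 + l \<noteq> 0" and t: "t \<in> ?U" for l t
    proof -
      have e: "x (- l) t * ((t - a)^2 + l) = - 2 * (t - a)" using xe[of t "- l"] nz by simp
      have "((t - a)^2 + l) * ((x l t * (2 * x l t - x (- l) t) - y t * (x l t - x (- l) t)) * ((t - a)^2 - l)^2)
        = ((t - a)^2 + l) * (4 * ((t - a)^2 + l))"
        using e xe[OF nz(1)] yt'[OF t] by algebra
      then have "(x l t * (2 * x l t - x (- l) t) - y t * (x l t - x (- l) t)) * ((t - a)^2 - l)^2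
        = 4 * ((t - a)^2 + l)"
        using nz(2) by (simp only: mult_cancel_left) simp
      then show ?thesis using nz(1) by (simp add: eq_half_iff eq_divide_eq divide_eq_eq)
    qed
    have rel': "(y t)^2 = (3 * x k t * x (- k) t - 3 * y t * (x k t + x (- k) t) + 2 * (y t)^2) / 2"
      if t: "t \<in> ?U" for t
    proof -
      have e: "x (- k) t * ((t - a)^2 + k) = - 2 * (t - a)" using xe[of t "- k"] k[OF t] by simp
      have "((t - a)^2 + k) * ((t - a)^2 - k) * (x k t * x (- k) t - y t * (x k t + x (- k) t)) = 0"
        using e xe[OF k(1)[OF t]] yt'[OF t] by algebra
      then have "x k t * x (- k) t - y t * (x k t + x (- k) t) = 0"
        using k[OF t] by simp
      then show ?thesis unfolding eq_half_iff by algebra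
    qed
    have sys: "chazy_system ?U (x k) (x (- k)) y"
      unfolding chazy_system_def
    proof (intro ballI conjI)
      fix t assume t: "t \<in> ?U"
      show "(x k has_field_derivative (x k t * (2 * x k t - x (- k) t) - y t * (x k t - x (- k) t)) / 2) (at t)"
        using dx[OF k(1)[OF t]] unfolding rel[OF k[OF t] t] .
      have nk: "(t - a)^2 - (- k) \<noteq> 0" "(t - a)^2 + - k \<noteq> 0" using k[OF t] by simp_all
      show "(x (- k) has_field_derivative
          (x (- k) t * (2 * x (- k) t - x k t) - y t * (x (- k) t - x k t)) / 2) (at t)"
        using dx[OF nk(1)] unfolding rel[OF nk t] minus_minus .
      show "(y has_field_derivative
          (3 * x k t * x (- k) t - 3 * y t * (x k t + x (- k) t) + 2 * (y t)^2) / 2) (at t)"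
        by (rule DERIV_cong[OF dy[OF t] rel'[OF t]])
    qed
    have "x k t \<noteq> x (- k) t" if "t \<in> ?U" for t
      using k[OF that] ta[OF that] k0 by (auto simp: x_def frac_eq_eq)
    moreover have "deriv (x k) c \<noteq> 0"
      using k[OF cU] unfolding DERIV_imp_deriv[OF dx[OF k(1)[OF cU]]] divide_eq_0_iff mult_eq_0_iff by simp
    ultimately show ?thesis by (rule chazy_system_global[OF A y r sys _ cU])
  qed
qed

text \<open>Each of \<open>y' - y^2\<close> and the discriminant is zero or nonzero off a discrete
  set. If the first is zero, explicit solutions are used; if only the second is zero,
  \<open>y\<close> is exceptional; otherwise the roots are distinct on a ball.\<close>

lemma chazy6_solution_obtained:
  assumes A: "open A" "connected A" "A \<noteq> {}" and sol: "chazy6_solution A y"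
    and nex: "\<not> chazy6_exceptional A y"
  shows "\<exists>x. chazy4_solution A x \<and> \<not> vanishes_identically A (to_chazy6_denom x) \<and>
             (\<forall>\<^sub>\<approx>t\<in>A. y t = to_chazy6 x t)"
proof -
  have my: "y meromorphic_on A"
    and eq: "\<forall>\<^sub>\<approx>t\<in>A. deriv (deriv (deriv y)) t =
        y t * deriv (deriv y) t + 5 * (deriv y t)^2 - (y t)^2 * deriv y t"
    using sol by (auto simp: chazy6_solution_def)
  have mB: "(\<lambda>t. deriv y t - (y t)^2) meromorphic_on A" by (intro meromorphic_intros my)
  have mD: "(\<lambda>t. (chazy6_sum y t)^2 - 4 * chazy6_prod y t) meromorphic_on A"
    unfolding chazy6_prod_def chazy6_sum_def by (intro meromorphic_intros my)
  consider "\<forall>\<^sub>\<approx>t\<in>A. deriv y t - (y t)^2 = 0" | "\<forall>\<^sub>\<approx>t\<in>A. deriv y t - (y t)^2 \<noteq> 0"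
    using meromorphic_imp_constant_or_avoid[OF mB A(1,2)] by blast
  then show ?thesis
  proof cases
    case 1
    have dich: "(\<forall>\<^sub>\<approx>t\<in>A. y t = 0) \<or> (\<forall>\<^sub>\<approx>t\<in>A. y t \<noteq> 0)"
      using meromorphic_imp_constant_or_avoid[OF my A(1,2)] .
    show ?thesis
    proof (cases "\<forall>\<^sub>\<approx>t\<in>A. y t = 0")
      case True
      obtain c r where U: "r > 0" "ball c r \<subseteq> A" "y holomorphic_on ball c r"
        "\<And>t. t \<in> ball c r \<Longrightarrow> deriv y t - (y t)^2 = 0 \<and> y t = 0"
        by (rule generic_ball[OF A(1,3) my eventually_conj[OF 1 True]]) (rule that, assumption+)
      show ?thesis by (rule chazy6_obtained_riccati[OF A(1,2) my U(1-3)]) (use U(4) in auto)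
    next
      case False
      with dich have *: "\<forall>\<^sub>\<approx>t\<in>A. y t \<noteq> 0" by blast
      obtain c r where U: "r > 0" "ball c r \<subseteq> A" "y holomorphic_on ball c r"
        "\<And>t. t \<in> ball c r \<Longrightarrow> deriv y t - (y t)^2 = 0 \<and> y t \<noteq> 0"
        by (rule generic_ball[OF A(1,3) my eventually_conj[OF 1 *]]) (rule that, assumption+)
      show ?thesis by (rule chazy6_obtained_riccati[OF A(1,2) my U(1-3)]) (use U(4) in auto)
    qed
  next
    case 2
    consider "\<forall>\<^sub>\<approx>t\<in>A. (chazy6_sum y t)^2 - 4 * chazy6_prod y t = 0"
      | "\<forall>\<^sub>\<approx>t\<in>A. (chazy6_sum y t)^2 - 4 * chazy6_prod y t \<noteq> 0"
      using meromorphic_imp_constant_or_avoid[OF mD A(1,2)] by blast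
    then show ?thesis
    proof cases
      case 1
      obtain c r where U: "r > 0" "ball c r \<subseteq> A" "y holomorphic_on ball c r"
        "\<And>t. t \<in> ball c r \<Longrightarrow> deriv y t - (y t)^2 \<noteq> 0 \<and>
          (chazy6_sum y t)^2 - 4 * chazy6_prod y t = 0 \<and>
          deriv (deriv (deriv y)) t = y t * deriv (deriv y) t + 5 * (deriv y t)^2 - (y t)^2 * deriv y t"
        by (rule generic_ball[OF A(1,3) my eventually_conj[OF 2 eventually_conj[OF 1 eq]]])
           (rule that, assumption+)
      have "chazy6_exceptional A y"
        by (rule chazy6_double_root_exceptional[OF A(1,2) my U(1-3)]) (use U(4) in auto)
      with nex show ?thesis by blast
    next
      case D: 2
      obtain c r where U: "r > 0" "ball c r \<subseteq> A" "y holomorphic_on ball c r"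
        "\<And>t. t \<in> ball c r \<Longrightarrow> deriv y t - (y t)^2 \<noteq> 0 \<and>
          (chazy6_sum y t)^2 - 4 * chazy6_prod y t \<noteq> 0 \<and>
          deriv (deriv (deriv y)) t = y t * deriv (deriv y) t + 5 * (deriv y t)^2 - (y t)^2 * deriv y t"
        by (rule generic_ball[OF A(1,3) my eventually_conj[OF 2 eventually_conj[OF D eq]]])
           (rule that, assumption+)
      let ?U = "ball c r"
      have eqU: "deriv (deriv (deriv y)) t = y t * deriv (deriv y) t + 5 * (deriv y t)^2 - (y t)^2 * deriv y t"
        and nz: "deriv y t \<noteq> (y t)^2"
        and D0: "(chazy6_sum y t)^2 - 4 * chazy6_prod y t \<noteq> 0" if "t \<in> ?U" for t
        using U(4)[OF that] by auto
      have hD: "(\<lambda>t. (chazy6_sum y t)^2 - 4 * chazy6_prod y t) holomorphic_on ?U"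
      proof -
        have "chazy6_sum y holomorphic_on ?U" "chazy6_prod y holomorphic_on ?U"
          unfolding holomorphic_on_open[OF open_ball]
          by (intro allI impI exI ballI, rule chazy6_sum_prod_derivs[OF open_ball U(3) _ eqU nz], assumption+)+
        then show ?thesis by (intro holomorphic_intros)
      qed
      \<comment> \<open>A ball is contractible, so the nonvanishing discriminant has a holomorphic
        root there; passing to \<open>A\<close> is left to
        \<open>chazy_system_global\<close>.\<close>
      obtain q where q: "q holomorphic_on ?U"
        "\<And>t. t \<in> ?U \<Longrightarrow> (chazy6_sum y t)^2 - 4 * chazy6_prod y t = (q t)^2"
        by (rule contractible_imp_holomorphic_sqrt[OF hD convex_imp_contractible[OF convex_ball] D0])
           (assumption, rule that, assumption+)
      have q0: "q t \<noteq> 0" if "t \<in> ?U" for t using q(2)[OF that] D0[OF that] by auto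
      define x where "x t = (chazy6_sum y t + q t) / 2" for t
      define v where "v t = (chazy6_sum y t - q t) / 2" for t
      have sys: "chazy_system ?U x v y"
        unfolding x_def[abs_def] v_def[abs_def]
        by (rule chazy_system_of_sqrt[OF open_ball U(3) eqU nz q(1) q(2)[symmetric] q0])
      have ne: "x t \<noteq> v t" if "t \<in> ?U" for t
        using q0[OF that] by (simp add: x_def v_def)
      show ?thesis
      \<comment> \<open>Either nonconstant root serves as the required solution, by symmetry; if
        both are constant, \<open>y\<close> is exceptional.\<close>
      proof (cases "\<exists>t\<in>?U. deriv x t \<noteq> 0 \<or> deriv v t \<noteq> 0")
        case True
        then obtain t where t: "t \<in> ?U" and "deriv x t \<noteq> 0 \<or> deriv v t \<noteq> 0" by blast
        then show ?thesis
          using chazy_system_global[OF A(1,2) my U(1,2) sys ne t]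
            chazy_system_global[OF A(1,2) my U(1,2) chazy_system_sym[OF sys] ne[symmetric] t]
          by blast
      next
        case False
        then have "chazy6_exceptional A y"
          by (intro chazy6_constant_exceptional[OF A(1,2) my U(1,2) sys ne nz]) auto
        with nex show ?thesis by blast
      qed
    qed
  qed
qed

theorem theorem8:
  fixes A :: "complex set"
  assumes "open A" and "connected A" and "A \<noteq> {}"
  shows
    "(\<forall>x. chazy4_solution A x \<and> \<not> vanishes_identically A (to_chazy6_denom x) \<longrightarrow>
        chazy6_solution A (to_chazy6 x)) \<and>
     (\<forall>y. chazy6_solution A y \<and> \<not> chazy6_exceptional A y \<longrightarrow>
        (\<exists>x. chazy4_solution A x \<and> \<not> vanishes_identically A (to_chazy6_denom x) \<and>
             (\<forall>\<^sub>\<approx>t\<in>A. y t = to_chazy6 x t))) \<and>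
     (\<forall>x. chazy4_solution A x \<and> \<not> vanishes_identically A (deriv x) \<longrightarrow>
        chazy4_solution A (chazy4_inv x) \<and>
        (\<not> vanishes_identically A (to_chazy6_denom x) \<and>
         \<not> vanishes_identically A (to_chazy6_denom (chazy4_inv x)) \<longrightarrow>
           (\<forall>\<^sub>\<approx>t\<in>A. to_chazy6 (chazy4_inv x) t = to_chazy6 x t)))"
  using chazy6_solution_to_chazy6[OF assms(1,2)] chazy6_solution_obtained[OF assms]
    chazy4_solution_chazy4_inv[OF assms(1,2)] to_chazy6_chazy4_inv[OF assms(1,2)]
  by blast

end
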